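(* Let $(W,S)$ be an affine Coxeter system of rank two and $\rho$ any representation of $H_q(W,S)$. Then there is an ordering of the collection $$\{H_1(\rho,u),\ H_2(\rho,u)\}\cup\{W_I(\rho,u)^{(-1)^{|I|}}: I\subsetneq S\}$$ such that the product of its members in this order equals $W(\rho,u)$ in $\mathrm{End}(V_\rho)[[u]]$.
   Context: Let $(W,S)$, $S=\{s_1,s_2,s_3\}$, be an affine Coxeter system of rank two, where $m_{ij}$ denotes the order of $s_is_j$, labelled so that $(m_{12},m_{23},m_{13})$ equals $(3,3,3)$ (type $\tilde A_2$), $(4,2,4)$ (type $\tilde C_2$) or $(6,2,3)$ (type $\tilde G_2$); $\ell$ is the length function and $W_I$ the subgroup generated by $I\subseteq S$. Define: in type $\tilde A_2$, $w_1=s_3s_2s_1$, $w_2=s_3s_1s_2$; in type $\tilde C_2$, $w_1=s_3s_1s_2s_1$, $w_2=s_3s_1s_2$; in type $\tilde G_2$, $w_1=s_3s_1s_2$, $w_2=s_3s_1s_2s_1s_2$. Let $H_i=\{w_i^k:k\in\mathbb{Z}_{\ge0}\}$. The Hecke algebra $H_q(W,S)$ is the associative algebra with basis $\{e_w\}_{w\in W}$ and multiplication characterized by $(e_s+1)(e_s-q)=0$ for $s\in S$ and $e_we_v=e_{wv}$ whenever $\ell(wv)=\ell(w)+\ell(v)$. For a representation $(\rho,V_\rho)$ and $D\subseteq W$, $D(\rho,u)=\sum_{w\in D}\rho(e_w)u^{\ell(w)}\in\mathrm{End}(V_\rho)[[u]]$; when $e\in D$ its constant term is the identity, so it is invertible,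 which gives meaning to $W_I(\rho,u)^{-1}$. *)

theory Defs
  imports Complex_Main
begin

datatype afftype = TA2 | TC2 | TG2

definition Gens :: "nat set" where
  "Gens = {1, 2, 3}"

definition cox_m :: "afftype \<Rightarrow> nat \<Rightarrow> nat \<Rightarrow> nat" where
  "cox_m t i j =
     (if i = j then 1
      else if {i, j} = {1, 2} then (case t of TA2 \<Rightarrow> 3 | TC2 \<Rightarrow> 4 | TG2 \<Rightarrow> 6)
      else if {i, j} = {2, 3} then (case t of TA2 \<Rightarrow> 3 | TC2 \<Rightarrow> 2 | TG2 \<Rightarrow> 2)
      else (case t of TA2 \<Rightarrow> 3 | TC2 \<Rightarrow> 4 | TG2 \<Rightarrow> 3))"

fun alt :: "nat \<Rightarrow> nat \<Rightarrow> nat \<Rightarrow> nat list" where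
  "alt s r 0 = []"
| "alt s r (Suc k) = s # alt r s k"

inductive cox_eqv :: "afftype \<Rightarrow> nat list \<Rightarrow> nat list \<Rightarrow> bool" for t where
  refl: "cox_eqv t xs xs"
| sym: "cox_eqv t xs ys \<Longrightarrow> cox_eqv t ys xs"
| trans: "cox_eqv t xs ys \<Longrightarrow> cox_eqv t ys zs \<Longrightarrow> cox_eqv t xs zs"
| cancel: "s \<in> Gens \<Longrightarrow> cox_eqv t (xs @ [s, s] @ ys) (xs @ ys)"
| braid: "s \<in> Gens \<Longrightarrow> r \<in> Gens \<Longrightarrow>
     cox_eqv t (xs @ alt s r (cox_m t s r) @ ys) (xs @ alt r s (cox_m t s r) @ ys)"

text \<open>The element of W represented by a word (its equivalence class).\<close>
definition cls :: "afftype \<Rightarrow> nat list \<Rightarrow> nat list set" where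
  "cls t xs = {ys. cox_eqv t xs ys}"

definition Wsub :: "afftype \<Rightarrow> nat set \<Rightarrow> nat list set set" where
  "Wsub t I = {cls t xs | xs. set xs \<subseteq> I}"

definition Wgrp :: "afftype \<Rightarrow> nat list set set" where
  "Wgrp t = Wsub t Gens"

definition len :: "nat list set \<Rightarrow> nat" where
  "len w = (LEAST n. \<exists>xs\<in>w. length xs = n)"

definition wword :: "afftype \<Rightarrow> nat \<Rightarrow> nat list" where
  "wword t i = (case t of
       TA2 \<Rightarrow> (if i = 1 then [3,2,1] else [3,1,2])
     | TC2 \<Rightarrow> (if i = 1 then [3,1,2,1] else [3,1,2])
     | TG2 \<Rightarrow> (if i = 1 then [3,1,2] else [3,1,2,1,2]))"

definition Hset :: "afftype \<Rightarrow> nat \<Rightarrow> nat list set set" where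
  "Hset t i = {cls t (concat (replicate k (wword t i))) | k. True}"

text \<open>A representation of H_q(W,S) on a k-vector space V (given by scalar
  multiplication scale), described through the images rho(e_w) of the basis elements
  e_w, w in W: rho(e_w) are linear endomorphisms, rho(e_1) = id,
  (rho(e_s)+1)(rho(e_s)-q) = 0, and rho(e_w)rho(e_v) = rho(e_{wv}) when
  l(wv) = l(w) + l(v).  (These relations characterize the multiplication of H_q, so
  such maps are exactly the algebra representations.)\<close>
definition hecke_rep ::
  "afftype \<Rightarrow> ('k::field \<Rightarrow> 'v::ab_group_add \<Rightarrow> 'v) \<Rightarrow> 'k \<Rightarrow> (nat list set \<Rightarrow> 'v \<Rightarrow> 'v) \<Rightarrow> bool" where
  "hecke_rep t scale q \<rho> \<longleftrightarrow>
     (\<forall>w\<in>Wgrp t. Vector_Spaces.linear scale scale (\<rho> w)) \<and>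
     \<rho> (cls t []) = id \<and>
     (\<forall>s\<in>Gens. \<forall>x. \<rho> (cls t [s]) (\<rho> (cls t [s]) x) - scale q (\<rho> (cls t [s]) x)
                    + \<rho> (cls t [s]) x - scale q x = 0) \<and>
     (\<forall>xs ys. set xs \<subseteq> Gens \<longrightarrow> set ys \<subseteq> Gens \<longrightarrow>
        len (cls t (xs @ ys)) = len (cls t xs) + len (cls t ys) \<longrightarrow>
        \<rho> (cls t (xs @ ys)) = \<rho> (cls t xs) \<circ> \<rho> (cls t ys))"

text \<open>A power series in u is the sequence of its coefficients.\<close>
definition ps_one :: "nat \<Rightarrow> 'v \<Rightarrow> 'v::zero" where
  "ps_one n = (if n = 0 then id else (\<lambda>_. 0))"

definition ps_mult :: "(nat \<Rightarrow> 'v \<Rightarrow> 'v::comm_monoid_add) \<Rightarrow> (nat \<Rightarrow> 'v \<Rightarrow> 'v) \<Rightarrow> nat \<Rightarrow> 'v \<Rightarrow> 'v" where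
  "ps_mult A B n = (\<lambda>x. \<Sum>i\<le>n. A i (B (n - i) x))"

definition ps_inv :: "(nat \<Rightarrow> 'v \<Rightarrow> 'v::comm_monoid_add) \<Rightarrow> nat \<Rightarrow> 'v \<Rightarrow> 'v" where
  "ps_inv A = (THE B. ps_mult A B = ps_one \<and> ps_mult B A = ps_one)"

definition ps_prod :: "(nat \<Rightarrow> 'v \<Rightarrow> 'v::comm_monoid_add) list \<Rightarrow> nat \<Rightarrow> 'v \<Rightarrow> 'v" where
  "ps_prod As = foldr ps_mult As ps_one"

definition ser :: "(nat list set \<Rightarrow> 'v \<Rightarrow> 'v::comm_monoid_add) \<Rightarrow> nat list set set \<Rightarrow> nat \<Rightarrow> 'v \<Rightarrow> 'v" where
  "ser \<rho> D n = (\<lambda>x. \<Sum>w\<in>{w\<in>D. len w = n}. \<rho> w x)"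

text \<open>Index set of the collection: Inl i stands for H_i(rho,u) (i = 1,2),
  Inr I stands for W_I(rho,u)^((-1)^|I|) for I a proper subset of S.\<close>
definition factor_index :: "(nat + nat set) set" where
  "factor_index = Inl ` {1, 2} \<union> Inr ` {I. I \<subset> Gens}"

definition factor :: "afftype \<Rightarrow> (nat list set \<Rightarrow> 'v \<Rightarrow> 'v::comm_monoid_add) \<Rightarrow> nat + nat set \<Rightarrow> nat \<Rightarrow> 'v \<Rightarrow> 'v" where
  "factor t \<rho> a = (case a of
       Inl i \<Rightarrow> ser \<rho> (Hset t i)
     | Inr I \<Rightarrow> (if even (card I) then ser \<rho> (Wsub t I) else ps_inv (ser \<rho> (Wsub t I))))"

end

theory Submission
  imports Defs "HOL-Computational_Algebra.Formal_Power_Series"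
begin

text \<open>
  Write \<open>x, y, z\<close> for the series \<open>\<rho>(e\<^sub>1)u, \<rho>(e\<^sub>2)u, \<rho>(e\<^sub>3)u\<close>.  For \<open>I\<close> a proper subset of \<open>S\<close>,
  every \<open>w\<close> factors uniquely and length-additively as an element of \<open>W\<^sub>I\<close> times a minimal coset
  representative, so \<open>W\<^sub>I(\<rho>,u)\<^sup>-\<^sup>1 W(\<rho>,u)\<close> is the series of those \<open>w\<close> without left descents in \<open>I\<close>.
  As \<open>W\<close> is infinite, no element has all of \<open>S\<close> as left descents, and inclusion-exclusion gives
  \<open>Q W(\<rho>,u) = 1\<close> for \<open>Q = \<Sum> (-1)\<^bsup>|I|\<^esup> W\<^sub>I(\<rho>,u)\<^sup>-\<^sup>1\<close>, the sum ranging over the proper subsets of \<open>S\<close>.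
  The elements \<open>w\<^sub>1, w\<^sub>2\<close> are straight, so that \<open>H\<^sub>i(\<rho>,u)\<close> is the inverse of \<open>1 - \<rho>(e\<^bsub>w\<^sub>i\<^esub>)u\<^bsup>\<ell>(w\<^sub>i)\<^esup>\<close>.
  It remains to show \<open>P Q = 1\<close> for the ordered product \<open>P\<close>; after clearing inverses this is a short
  identity between noncommutative polynomials in \<open>x, y, z\<close> that uses the braid relations only.
\<close>

section \<open>Words and their classes\<close>

lemma cox_eqv_context:
  assumes "cox_eqv t xs ys"
  shows "cox_eqv t (us @ xs @ vs) (us @ ys @ vs)"
  using assms
proof induction
  case (refl xs)
  show ?case by (rule cox_eqv.refl)
next
  case (sym xs ys)
  then show ?case by (blast intro: cox_eqv.sym)
next
  case (trans xs ys zs)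
  then show ?case by (blast intro: cox_eqv.trans)
next
  case (cancel s xs ys)
  show ?case using cox_eqv.cancel[OF cancel, of t "us @ xs" "ys @ vs"] by simp
next
  case (braid s r xs ys)
  show ?case using cox_eqv.braid[OF braid, of t "us @ xs" "ys @ vs"] by simp
qed

lemma cls_eq_iff: "cls t xs = cls t ys \<longleftrightarrow> cox_eqv t xs ys"
  unfolding cls_def by (blast intro: cox_eqv.refl cox_eqv.sym cox_eqv.trans)

lemma cls_append_cong:
  assumes "cls t xs = cls t xs'" "cls t ys = cls t ys'"
  shows "cls t (xs @ ys) = cls t (xs' @ ys')"
proof -
  have "cox_eqv t (xs @ ys) (xs' @ ys)"
    using cox_eqv_context[of t xs xs' "[]" ys] assms(1) by (simp add: cls_eq_iff)
  moreover have "cox_eqv t (xs' @ ys) (xs' @ ys')"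
    using cox_eqv_context[of t ys ys' xs' "[]"] assms(2) by (simp add: cls_eq_iff)
  ultimately show ?thesis unfolding cls_eq_iff by (rule cox_eqv.trans)
qed

lemma cls_Cons_cong: "cls t xs = cls t ys \<Longrightarrow> cls t (s # xs) = cls t (s # ys)"
  using cls_append_cong[of t "[s]" "[s]" xs ys] by simp

lemma cls_cancel: "s \<in> Gens \<Longrightarrow> cls t (s # s # xs) = cls t xs"
  unfolding cls_eq_iff using cox_eqv.cancel[of s t "[]" xs] by simp

lemma cls_braid:
  "s \<in> Gens \<Longrightarrow> r \<in> Gens \<Longrightarrow>
    cls t (alt s r (cox_m t s r)) = cls t (alt r s (cox_m t s r))"
  unfolding cls_eq_iff using cox_eqv.braid[of s r t "[]" "[]"] by simp

lemma cls_rev_append: "set us \<subseteq> Gens \<Longrightarrow> cls t (rev us @ us @ ys) = cls t ys"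
proof (induction us arbitrary: ys)
  case (Cons s us)
  have "cls t (rev (s # us) @ (s # us) @ ys) = cls t (rev us @ s # s # us @ ys)"
    by simp
  also have "\<dots> = cls t (rev us @ us @ ys)"
    by (rule cls_append_cong[OF HOL.refl cls_cancel]) (use Cons.prems in auto)
  also have "\<dots> = cls t ys"
    using Cons by simp
  finally show ?case .
qed simp

lemma set_alt: "set (alt s r k) \<subseteq> {s, r}"
  by (induction k arbitrary: s r) auto

lemma length_alt [simp]: "length (alt s r k) = k"
  by (induction k arbitrary: s r) auto

lemma cox_m_sym: "cox_m t s r = cox_m t r s"
  by (auto simp: cox_m_def insert_commute)

lemma cox_m_pos: "0 < cox_m t s r"
  by (auto simp: cox_m_def split: afftype.splits)

text \<open>Classes are formed among all lists of naturals. Neither relation introduces a letter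
  outside \<open>Gens\<close>, so shortest representatives can be taken over the generators.\<close>

lemma cox_eqv_letters:
  "cox_eqv t xs ys \<Longrightarrow> set xs \<subseteq> Gens \<longleftrightarrow> set ys \<subseteq> Gens"
proof (induction rule: cox_eqv.induct)
  case (braid s r xs ys)
  then have "set (alt s r n) \<subseteq> Gens" "set (alt r s n) \<subseteq> Gens" for n
    using set_alt[of s r n] set_alt[of r s n] by auto
  then show ?case by auto
qed auto

lemma cox_eqv_parity: "cox_eqv t xs ys \<Longrightarrow> even (length xs) = even (length ys)"
  by (induction rule: cox_eqv.induct) auto

text \<open>Since braid relations exchange the two longest alternating words, \<open>s # _\<close> never has to
  leave the alternating words of length at most \<open>m\<close>.\<close>

lemma dihedral_word_alt:
  assumes "s \<in> Gens" "r \<in> Gens" "set xs \<subseteq> {s, r}"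
  shows "\<exists>k a b. k \<le> length xs \<and> k \<le> cox_m t s r \<and> {a, b} = {s, r} \<and>
           cls t xs = cls t (alt a b k)"
  using assms(3)
proof (induction xs)
  case Nil
  show ?case by (rule exI[of _ 0]) auto
next
  case (Cons c xs)
  let ?m = "cox_m t s r"
  obtain k a b where k: "k \<le> length xs" "k \<le> ?m" "{a, b} = {s, r}"
      and eq: "cls t xs = cls t (alt a b k)"
    using Cons by auto
  have ab: "a \<in> Gens" "b \<in> Gens"
    using k(3) assms by (auto simp: doubleton_eq_iff)
  have m: "cox_m t a b = ?m"
    using k(3) by (auto simp: doubleton_eq_iff cox_m_sym)
  have c: "c = a \<or> c = b"
    using Cons.prems k(3) by auto
  have eqc: "cls t (c # xs) = cls t (c # alt a b k)"
    by (rule cls_Cons_cong[OF eq])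
  have down: "cls t (a # alt a b (Suc n)) = cls t (alt b a n)" if "a \<in> Gens" for a b n
    using that by (simp add: cls_cancel)
  have witness: ?case
    if "k' \<le> Suc (length xs)" "k' \<le> ?m" "{a', b'} = {s, r}"
      "cls t (c # xs) = cls t (alt a' b' k')" for k' a' b'
    using that by auto
  have ba: "{b, a} = {s, r}"
    using k(3) by blast
  consider "c = b" "k < ?m" | "c = b" "k = ?m" | "c = a" "k = 0" | n where "c = a" "k = Suc n"
    using c k(2) by (cases k) (auto simp: le_less)
  then show ?case
  proof cases
    case 1
    then show ?thesis
      using eqc k by (intro witness[OF _ _ ba, of "Suc k"]) auto
  next
    case 2
    then obtain n where n: "?m = Suc n" using cox_m_pos[of t s r] by (cases ?m) auto
    have "cls t (c # xs) = cls t (b # alt b a (Suc n))"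
      using eqc cls_Cons_cong[OF cls_braid[OF ab, of t], of b] m n 2 by simp
    also have "\<dots> = cls t (alt a b n)"
      using down ab by simp
    finally show ?thesis
      using k n 2 by (intro witness[OF _ _ k(3), of n]) auto
  next
    case 3
    then show ?thesis
      using eqc cox_m_pos[of t s r]
      by (intro witness[OF _ _ k(3), of 1]) auto
  next
    case (4 n)
    then have "cls t (c # xs) = cls t (alt b a n)"
      using eqc down ab by simp
    then show ?thesis
      using k 4 by (intro witness[OF _ _ ba, of n]) auto
  qed
qed

section \<open>Length\<close>

lemma len_cls_le: "len (cls t xs) \<le> length xs"
  unfolding len_def cls_def by (rule Least_le) (auto intro: cox_eqv.refl)

lemma reduced_word_exists:
  assumes "set xs \<subseteq> Gens"
  obtains ys where "cls t ys = cls t xs" "length ys = len (cls t xs)" "set ys \<subseteq> Gens"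
proof -
  have "\<exists>ys\<in>cls t xs. length ys = len (cls t xs)"
    unfolding len_def
    by (rule LeastI_ex) (auto simp: cls_def intro: cox_eqv.refl)
  then obtain ys where ys: "cox_eqv t xs ys" "length ys = len (cls t xs)"
    by (auto simp: cls_def)
  then show ?thesis
    using that[of ys] assms cox_eqv_letters cls_eq_iff cox_eqv.sym by metis
qed

lemma len_append_le:
  assumes "set xs \<subseteq> Gens" "set ys \<subseteq> Gens"
  shows "len (cls t (xs @ ys)) \<le> len (cls t xs) + len (cls t ys)"
proof -
  obtain xs' where xs': "cls t xs' = cls t xs" "length xs' = len (cls t xs)"
    using reduced_word_exists[OF assms(1)] by blast
  obtain ys' where ys': "cls t ys' = cls t ys" "length ys' = len (cls t ys)"
    using reduced_word_exists[OF assms(2)] by blast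
  have "cls t (xs @ ys) = cls t (xs' @ ys')"
    using cls_append_cong xs'(1) ys'(1) by metis
  then show ?thesis
    using len_cls_le[of t "xs' @ ys'"] xs' ys' by simp
qed

text \<open>As \<open>s\<close> cancels against itself, prefixing it changes the length by at most
  one in either direction. Both relations preserve the parity of words, which excludes
  equality.\<close>

lemma len_Cons_cases:
  assumes "s \<in> Gens" "set xs \<subseteq> Gens"
  shows "len (cls t (s # xs)) = Suc (len (cls t xs)) \<or> len (cls t xs) = Suc (len (cls t (s # xs)))"
proof -
  have le1: "len (cls t (s # ys)) \<le> Suc (len (cls t ys))" if "set ys \<subseteq> Gens" for ys
    using len_append_le[of "[s]" ys t] len_cls_le[of t "[s]"] assms(1) that by simp
  have le2: "len (cls t xs) \<le> Suc (len (cls t (s # xs)))"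
    using le1[of "s # xs"] assms cls_cancel[of s t xs] by simp
  obtain ys where ys: "cls t ys = cls t xs" "length ys = len (cls t xs)"
    using reduced_word_exists[OF assms(2)] by blast
  obtain zs where zs: "cls t zs = cls t (s # xs)" "length zs = len (cls t (s # xs))"
    using reduced_word_exists[of "s # xs" t] assms by (metis insert_subset list.set(2))
  have "even (length zs) \<noteq> even (length ys)"
    using cox_eqv_parity ys(1) zs(1) unfolding cls_eq_iff by fastforce
  then have "len (cls t (s # xs)) \<noteq> len (cls t xs)"
    using ys zs by auto
  then show ?thesis
    using le1[OF assms(2)] le2 by linarith
qed

lemma len_Nil [simp]: "len (cls t []) = 0"
  using len_cls_le[of t "[]"] by simp

lemma len_eq_0_iff: "set xs \<subseteq> Gens \<Longrightarrow> len (cls t xs) = 0 \<longleftrightarrow> cls t xs = cls t []"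
  by (metis len_Nil length_0_conv reduced_word_exists)

section \<open>The geometric action\<close>

text \<open>The contragredient of the geometric representation, in coordinates given by the simple
  coroots; \<open>coef\<close> collects the negated off-diagonal entries of a Cartan matrix.  It acts on the
  integer vectors, and \<open>pt\<close> follows the orbit of a dominant regular point.\<close>

definition coef :: "afftype \<Rightarrow> nat \<Rightarrow> nat \<Rightarrow> int" where
  "coef t s r = (if s \<notin> Gens \<or> r \<notin> Gens then 0 else case t of
       TA2 \<Rightarrow> 1
     | TC2 \<Rightarrow> (if s = 1 then 2 else if r = 1 then 1 else 0)
     | TG2 \<Rightarrow> (if s = 1 then (if r = 2 then 3 else 1) else if r = 1 then 1 else 0))"

definition act :: "afftype \<Rightarrow> nat \<Rightarrow> (nat \<Rightarrow> int) \<Rightarrow> nat \<Rightarrow> int" where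
  "act t s v = (\<lambda>r. if r = s then - v s else v r + coef t s r * v s)"

definition pt :: "afftype \<Rightarrow> nat list \<Rightarrow> nat \<Rightarrow> int" where
  "pt t xs = foldr (act t) xs (\<lambda>_. 1)"

lemma pt_Nil [simp]: "pt t [] = (\<lambda>_. 1)"
  by (simp add: pt_def)

lemma pt_Cons: "pt t (s # xs) = act t s (pt t xs)"
  by (simp add: pt_def)

lemma pt_append: "pt t (xs @ ys) = foldr (act t) xs (pt t ys)"
  by (simp add: pt_def)

lemma act_act: "act t s (act t s v) = v"
  by (auto simp: act_def)

lemma act_self: "act t s v s = - v s"
  by (simp add: act_def)

lemma alt_numeral:
  "alt s r 1 = [s]" "alt s r 2 = [s, r]" "alt s r 3 = [s, r, s]" "alt s r 4 = [s, r, s, r]"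
  "alt s r 5 = [s, r, s, r, s]" "alt s r 6 = [s, r, s, r, s, r]"
  by (simp_all add: eval_nat_numeral)

text \<open>The product of the two opposite coefficients is 0, 1, 2 or 3, and it corresponds to the
  order 2, 3, 4 or 6. Orders 4 and 6 have two orientations. This reduces each rank-two statement
  about \<open>act\<close> to six computations.\<close>

lemma coef_cases:
  assumes "s \<in> Gens" "r \<in> Gens" "s \<noteq> r"
  obtains "cox_m t s r = 2" "coef t s r = 0" "coef t r s = 0"
    | "cox_m t s r = 3" "coef t s r = 1" "coef t r s = 1"
    | "cox_m t s r = 4" "coef t s r = 1" "coef t r s = 2"
    | "cox_m t s r = 4" "coef t s r = 2" "coef t r s = 1"
    | "cox_m t s r = 6" "coef t s r = 1" "coef t r s = 3"
    | "cox_m t s r = 6" "coef t s r = 3" "coef t r s = 1"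
  using assms by (cases t) (auto simp: cox_m_def coef_def Gens_def doubleton_eq_iff)

lemma act_braid:
  assumes "s \<in> Gens" "r \<in> Gens"
  shows "foldr (act t) (alt s r (cox_m t s r)) v = foldr (act t) (alt r s (cox_m t s r)) v"
proof (cases "s = r")
  case False
  show ?thesis
  proof
    fix i
    show "foldr (act t) (alt s r (cox_m t s r)) v i = foldr (act t) (alt r s (cox_m t s r)) v i"
      \<comment> \<open>For a third coordinate \<open>i\<close> the coefficients
        \<open>coef t s i\<close> and \<open>coef t r i\<close> stay symbolic; the identity holds
        whatever their values are.\<close>
      by (cases rule: coef_cases[OF assms False, of t]; cases "i = s"; cases "i = r")
        (use False in \<open>simp_all add: alt_numeral act_def algebra_simps\<close>)
  qed
qed simp

lemma cox_eqv_act: "cox_eqv t xs ys \<Longrightarrow> foldr (act t) xs v = foldr (act t) ys v"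
proof (induction arbitrary: v rule: cox_eqv.induct)
  case (cancel s xs ys)
  then show ?case by (simp add: act_act)
next
  case (braid s r xs ys)
  then show ?case by (simp add: act_braid)
qed auto

lemma pt_cong: "cls t xs = cls t ys \<Longrightarrow> pt t xs = pt t ys"
  unfolding cls_eq_iff pt_def by (rule cox_eqv_act)

text \<open>This is where the infinitude of W enters: an invariant linear form with positive
  coefficients is positive on the whole orbit, so the coordinates cannot all be nonpositive.\<close>

lemma pt_not_all_negative: "\<exists>s\<in>Gens. 0 < pt t xs s"
proof -
  \<comment> \<open>The vector (d, 1, 1) spans the kernel of the Cartan matrix: the
    \<open>coef\<close>-weighted sum of the entries other than that at s is twice the entry at s. It
    is the imaginary root in simple coordinates.\<close>
  define d :: int where "d = (if t = TA2 then 1 else 2)"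
  define \<delta> where "\<delta> v = d * v 1 + v 2 + v 3" for v :: "nat \<Rightarrow> int"
  have "\<delta> (act t s v) = \<delta> v" for s v
    by (cases "s \<in> Gens"; cases t)
      (auto simp: \<delta>_def d_def act_def coef_def Gens_def algebra_simps)
  then have "\<delta> (pt t xs) = \<delta> (\<lambda>_. 1)"
    by (induction xs) (auto simp: pt_Cons)
  moreover have "0 < \<delta> (\<lambda>_. 1)" "0 < d"
    by (auto simp: \<delta>_def d_def)
  ultimately show ?thesis
    unfolding \<delta>_def Gens_def by (smt (verit) insertCI mult_nonneg_nonpos)
qed

text \<open>The value is a combination of \<open>v s\<close> and \<open>v r\<close> whose
  coefficients are those of a positive root of the rank-two subsystem, as long as
  \<open>s # alt r s j\<close> does not exceed the longest length m. Since m is at most 6, this is a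
  finite computation.\<close>

lemma act_alt_positive:
  assumes "s \<in> Gens" "r \<in> Gens" "s \<noteq> r" "0 < v s" "0 < v r" "j < cox_m t s r"
  shows "0 < foldr (act t) (alt r s j) v s"
proof -
  have "j < 6"
    using assms(6) by (auto simp: cox_m_def split: afftype.splits if_splits)
  then consider "j = 0" | "j = 1" | "j = 2" | "j = 3" | "j = 4" | "j = 5"
    by linarith
  then show ?thesis
    by cases (rule coef_cases[OF assms(1-3), of t]; use assms(3-6) in
      \<open>simp add: alt_numeral act_def algebra_simps del: alt.simps(2) One_nat_def\<close>)+
qed

text \<open>This is the classical fact that an ascent \<open>s\<close> of w sends the simple root of
  \<open>s\<close> to a positive root under the inverse of w. By induction on length, let
  \<open>r\<close> be the first letter of a reduced word, split off a longest left factor in the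
  dihedral group of \<open>s\<close> and \<open>r\<close>, and use induction on the remainder. The
  dihedral factor is then settled by \<open>act_alt_positive\<close>.\<close>

lemma pt_positive_of_len_less:
  assumes "s \<in> Gens" "set xs \<subseteq> Gens" "len (cls t xs) < len (cls t (s # xs))"
  shows "0 < pt t xs s"
  using assms
proof (induction "len (cls t xs)" arbitrary: xs s rule: less_induct)
  case less
  note s = \<open>s \<in> Gens\<close> and xs = \<open>set xs \<subseteq> Gens\<close> and up = less.prems(3)
  show ?case
  proof (cases "len (cls t xs) = 0")
    case True
    then show ?thesis
      using len_eq_0_iff[OF xs] pt_cong[of t xs "[]"] by simp
  next
    case False
    obtain ys where ys: "cls t ys = cls t xs" "length ys = len (cls t xs)" "set ys \<subseteq> Gens"
      using reduced_word_exists[OF xs] by blast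
    obtain r zs where ys_eq: "ys = r # zs"
      using ys(2) False by (cases ys) auto
    have r: "r \<in> Gens" and zs: "set zs \<subseteq> Gens"
      using ys(3) ys_eq by auto
    have len_zs: "Suc (len (cls t zs)) = len (cls t xs)"
      using len_Cons_cases[OF r zs, of t] len_cls_le[of t zs] ys(1,2) ys_eq by simp
    have "r \<noteq> s"
    proof
      assume "r = s"
      then have "cls t (s # xs) = cls t zs"
        using cls_Cons_cong[OF ys(1), of s] cls_cancel[OF s] ys_eq by simp
      then show False using up len_zs by simp
    qed
    \<comment> \<open>Length-additive factorizations through the dihedral group of \<open>s\<close>
      and \<open>r\<close>, indexed by the length \<open>k\<close> of the remainder; a factorization
      with least \<open>k\<close> is used.\<close>
    define split where "split k \<longleftrightarrow> (\<exists>us vs. set us \<subseteq> {s, r} \<and> set vs \<subseteq> Gens \<and>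
        cls t xs = cls t (us @ vs) \<and> length us + len (cls t vs) = len (cls t xs) \<and>
        len (cls t vs) = k)" for k
    have split_zs: "split (len (cls t zs))"
      unfolding split_def
      by (rule exI[of _ "[r]"], rule exI[of _ zs]) (use ys(1) ys_eq zs len_zs in auto)
    define k where "k = (LEAST k. split k)"
    have "split k"
      unfolding k_def by (rule LeastI[of split, OF split_zs])
    then obtain us vs where us: "set us \<subseteq> {s, r}" and vs: "set vs \<subseteq> Gens"
        and eq: "cls t xs = cls t (us @ vs)" and len_eq: "length us + len (cls t vs) = len (cls t xs)"
        and k: "len (cls t vs) = k"
      unfolding split_def by blast
    have k_less: "len (cls t vs) < len (cls t xs)"
      using Least_le[of split, OF split_zs] k len_zs unfolding k_def by linarith
    \<comment> \<open>If the remainder had a left descent \<open>a\<close>, moving \<open>a\<close>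
      into the dihedral factor would give a factorization with a smaller \<open>k\<close>. So both
      letters are ascents and the induction hypothesis applies.\<close>
    have pos: "0 < pt t vs a" if a: "a \<in> {s, r}" for a
    proof (rule less.hyps[OF k_less _ vs])
      show aG: "a \<in> Gens" using a s r by auto
      show "len (cls t vs) < len (cls t (a # vs))"
      proof (rule ccontr)
        assume "\<not> ?thesis"
        then have down: "Suc (len (cls t (a # vs))) = len (cls t vs)"
          using len_Cons_cases[OF aG vs, of t] by auto
        have "cls t ((us @ [a]) @ (a # vs)) = cls t (us @ vs)"
          using cls_append_cong[OF HOL.refl cls_cancel[OF aG], of t us vs] by simp
        then have eq_a: "cls t xs = cls t ((us @ [a]) @ (a # vs))"
          using eq by simp
        have split_a: "split (len (cls t (a # vs)))"
          unfolding split_def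
          by (rule exI[of _ "us @ [a]"], rule exI[of _ "a # vs"])
            (use us vs a aG eq_a len_eq down in auto)
        then show False
          using Least_le[of split, OF split_a] k down unfolding k_def by linarith
      qed
    qed
    obtain j a b where j: "j \<le> length us" "j \<le> cox_m t s r" "{a, b} = {s, r}"
        and us_alt: "cls t us = cls t (alt a b j)"
      using dihedral_word_alt[OF s r us, of t] that by metis
    \<comment> \<open>A form of \<open>us\<close> that starts with \<open>s\<close> and is no longer
      than \<open>us\<close> would let \<open>s\<close> cancel, making \<open>s # xs\<close> shorter
      than \<open>xs\<close>.\<close>
    have not_s: False if "cls t us = cls t (s # ws)" "length ws < length us" "set ws \<subseteq> Gens" for ws
    proof -
      have "cls t (s # xs) = cls t (s # (s # ws) @ vs)"
        using cls_Cons_cong[OF eq, of s] cls_append_cong[OF that(1) HOL.refl, of vs]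
          cls_Cons_cong by (metis append_Cons)
      also have "\<dots> = cls t (ws @ vs)"
        using cls_cancel[OF s] by simp
      finally have "len (cls t (s # xs)) \<le> length ws + len (cls t vs)"
        using len_append_le[OF that(3) vs, of t] len_cls_le[of t ws] by simp
      then show False
        using up len_eq that(2) by linarith
    qed
    have alt_G: "set (alt a b n) \<subseteq> Gens" "set (alt b a n) \<subseteq> Gens" for n
      using set_alt[of a b n] set_alt[of b a n] j(3) s r by (auto simp: doubleton_eq_iff)
    have eq': "cls t xs = cls t (alt a b j @ vs)"
      using eq cls_append_cong[OF us_alt HOL.refl] by metis
    have "cls t xs = cls t (alt r s j @ vs) \<and> j < cox_m t s r"
    proof (cases j)
      case 0
      then show ?thesis using eq' cox_m_pos by simp
    next
      case (Suc n)
      have a: "a = r"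
      proof (rule ccontr)
        assume "a \<noteq> r"
        then have "a = s" "b = r" using j(3) by (auto simp: doubleton_eq_iff)
        then show False
          using not_s[of "alt r s n"] us_alt Suc j(1) alt_G by simp
      qed
      then have b: "b = s"
        using j(3) \<open>r \<noteq> s\<close> by (auto simp: doubleton_eq_iff)
      \<comment> \<open>At full length the braid relation turns the word into one that starts with
        \<open>s\<close>, which \<open>not_s\<close> forbids.\<close>
      have "j \<noteq> cox_m t s r"
      proof
        assume "j = cox_m t s r"
        then have "cls t us = cls t (s # alt r s n)"
          using us_alt cls_braid[OF s r, of t] a b Suc by (metis alt.simps(2))
        then show False
          using not_s[of "alt r s n"] Suc j(1) alt_G a b by simp
      qed
      then show ?thesis using j(2) a b eq' by simp
    qed
    then have "pt t xs = pt t (alt r s j @ vs)" "j < cox_m t s r"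
      using pt_cong by blast+
    then show ?thesis
      using act_alt_positive[OF s r, of "pt t vs" j t] pos[of s] pos[of r] \<open>r \<noteq> s\<close> by (simp add: pt_append)
  qed
qed

text \<open>For the first claim, if \<open>s\<close> were a descent of \<open>xs\<close>, it would
  be an ascent of \<open>s # xs\<close>; but the action of \<open>s\<close> negates the coordinate
  at \<open>s\<close>. The second claim is the contrapositive of
  \<open>pt_positive_of_len_less\<close>.\<close>

lemma pt_sign:
  assumes "s \<in> Gens" "set xs \<subseteq> Gens"
  shows "0 < pt t xs s \<Longrightarrow> len (cls t (s # xs)) = Suc (len (cls t xs))"
    and "\<not> 0 < pt t xs s \<Longrightarrow> len (cls t xs) = Suc (len (cls t (s # xs)))"
proof -
  show "len (cls t (s # xs)) = Suc (len (cls t xs))" if "0 < pt t xs s"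
  proof (rule ccontr)
    assume "\<not> ?thesis"
    then have "len (cls t (s # xs)) < len (cls t (s # s # xs))"
      using len_Cons_cases[OF assms, of t] cls_cancel[OF assms(1), of t xs] by simp
    then have "0 < pt t (s # xs) s"
      using assms by (intro pt_positive_of_len_less) auto
    then show False
      using that by (simp add: pt_Cons act_self)
  qed
  show "len (cls t xs) = Suc (len (cls t (s # xs)))" if "\<not> 0 < pt t xs s"
    using len_Cons_cases[OF assms, of t] pt_positive_of_len_less[OF assms, of t] that by auto
qed

section \<open>Reduced words\<close>

text \<open>Read from the right, every letter meets a positive coordinate, so by
  \<open>pt_sign\<close> it raises the length when \<open>v\<close> is an orbit point. The vector is
  left arbitrary so that one period of a power can be examined on a whole cone of vectors.\<close>

fun pos_word :: "afftype \<Rightarrow> nat list \<Rightarrow> (nat \<Rightarrow> int) \<Rightarrow> bool" where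
  "pos_word t [] v \<longleftrightarrow> True"
| "pos_word t (s # xs) v \<longleftrightarrow> pos_word t xs v \<and> 0 < foldr (act t) xs v s"

lemma pos_word_append:
  "pos_word t (xs @ ys) v \<longleftrightarrow> pos_word t ys v \<and> pos_word t xs (foldr (act t) ys v)"
  by (induction xs) auto

lemma len_append_pos_word:
  assumes "set xs \<subseteq> Gens" "set ys \<subseteq> Gens" "pos_word t xs (pt t ys)"
  shows "len (cls t (xs @ ys)) = length xs + len (cls t ys)"
  using assms by (induction xs) (auto simp: pt_sign(1) pt_append)

lemma pos_word_alt:
  assumes "s \<in> Gens" "r \<in> Gens" "0 < v s" "0 < v r" "k \<le> cox_m t s r"
  shows "pos_word t (alt s r k) v"
proof (cases "s = r")
  case True
  then have "k = 0 \<or> k = 1"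
    using assms(5) by (auto simp: cox_m_def)
  then show ?thesis using assms by auto
next
  case False
  then show ?thesis
    using assms
  proof (induction k arbitrary: s r)
    case (Suc k)
    have "pos_word t (alt r s k) v"
      using Suc.prems by (intro Suc.IH) (auto simp: cox_m_sym[of t r s])
    then show ?case
      using act_alt_positive[of s r v k t] Suc.prems by simp
  qed simp
qed

text \<open>After rewriting \<open>us\<close> as a reduced alternating word, each of its letters is
  an ascent over \<open>vs\<close>, because both coordinates start positive. The case
  \<open>s = r\<close> is included on purpose: it serves the rank-one parabolic subgroups.\<close>

lemma len_parabolic_append:
  assumes "s \<in> Gens" "r \<in> Gens" "set us \<subseteq> {s, r}" "set vs \<subseteq> Gens"
    and "0 < pt t vs s" "0 < pt t vs r"
  shows "len (cls t (us @ vs)) = len (cls t us) + len (cls t vs)"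
proof -
  obtain k a b where k: "k \<le> cox_m t s r" "{a, b} = {s, r}" and eq: "cls t us = cls t (alt a b k)"
    using dihedral_word_alt[OF assms(1-3), of t] that by metis
  have ab: "a \<in> Gens" "b \<in> Gens" "cox_m t a b = cox_m t s r"
    using k(2) assms by (auto simp: doubleton_eq_iff cox_m_sym)
  have G: "set (alt a b k) \<subseteq> Gens"
    using set_alt[of a b k] ab by auto
  have len_alt: "len (cls t (alt a b k @ ws)) = k + len (cls t ws)"
    if "set ws \<subseteq> Gens" "0 < pt t ws a" "0 < pt t ws b" for ws
    using len_append_pos_word[OF G that(1)] pos_word_alt[of a b] that ab k(1) by simp
  have "cls t (us @ vs) = cls t (alt a b k @ vs)"
    by (rule cls_append_cong[OF eq HOL.refl])
  moreover have "0 < pt t vs a" "0 < pt t vs b"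
    using assms k(2) by (auto simp: doubleton_eq_iff)
  ultimately show ?thesis
    using len_alt[of vs] len_alt[of "[]"] assms(4) eq by simp
qed

section \<open>Parabolic cosets and their minimal representatives\<close>

lemma coset_decomposition:
  assumes "I \<subseteq> Gens" "set xs \<subseteq> Gens"
  shows "\<exists>us vs. set us \<subseteq> I \<and> set vs \<subseteq> Gens \<and> (\<forall>s\<in>I. 0 < pt t vs s) \<and> cls t xs = cls t (us @ vs)"
  using assms(2)
proof (induction "len (cls t xs)" arbitrary: xs rule: less_induct)
  case less
  show ?case
  proof (cases "\<forall>s\<in>I. 0 < pt t xs s")
    case True
    show ?thesis
      by (rule exI[of _ "[]"], rule exI[of _ xs]) (use True less.prems in simp)
  next
    case False
    then obtain s where s: "s \<in> I" "\<not> 0 < pt t xs s" by blast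
    have sG: "s \<in> Gens" using s(1) assms(1) by blast
    have "len (cls t (s # xs)) < len (cls t xs)"
      using pt_sign(2)[OF sG less.prems s(2)] by simp
    from less.hyps[OF this] obtain us vs where uv: "set us \<subseteq> I" "set vs \<subseteq> Gens"
        "\<forall>s\<in>I. 0 < pt t vs s" "cls t (s # xs) = cls t (us @ vs)"
      using sG less.prems by auto
    have eq: "cls t xs = cls t ((s # us) @ vs)"
      using cls_Cons_cong[OF uv(4), of s] cls_cancel[OF sG, of t xs] by simp
    show ?thesis
      by (rule exI[of _ "s # us"], rule exI[of _ vs]) (use uv s(1) eq in simp)
  qed
qed

text \<open>The element d carrying one representative to the other lies in the parabolic subgroup.
  Length additivity in both directions makes the lengths of d and of its inverse add up to 0, so d
  is trivial.\<close>

lemma coset_decomposition_unique: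
  assumes "s \<in> Gens" "r \<in> Gens"
    and us: "set us \<subseteq> {s, r}" "set us' \<subseteq> {s, r}"
    and vs: "set vs \<subseteq> Gens" "0 < pt t vs s" "0 < pt t vs r"
    and vs': "set vs' \<subseteq> Gens" "0 < pt t vs' s" "0 < pt t vs' r"
    and eq: "cls t (us @ vs) = cls t (us' @ vs')"
  shows "cls t us = cls t us' \<and> cls t vs = cls t vs'"
proof -
  have G: "set us \<subseteq> Gens" "set us' \<subseteq> Gens"
    using us assms(1,2) by auto
  have 1: "cls t vs' = cls t ((rev us' @ us) @ vs)"
    using cls_append_cong[OF HOL.refl eq, of "rev us'"] cls_rev_append[OF G(2)] by simp
  have 2: "cls t vs = cls t ((rev us @ us') @ vs')"
    using cls_append_cong[OF HOL.refl eq, of "rev us"] cls_rev_append[OF G(1)] by simp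
  have "len (cls t vs') = len (cls t (rev us' @ us)) + len (cls t vs)"
    unfolding 1 by (rule len_parabolic_append[OF assms(1,2)]) (use us vs in auto)
  moreover have "len (cls t vs) = len (cls t (rev us @ us')) + len (cls t vs')"
    unfolding 2 by (rule len_parabolic_append[OF assms(1,2)]) (use us vs' in auto)
  ultimately have "len (cls t (rev us' @ us)) = 0" by simp
  then have triv: "cls t (rev us' @ us) = cls t []"
    using len_eq_0_iff[of "rev us' @ us" t] G by simp
  have "cls t vs = cls t vs'"
    using cls_append_cong[OF triv HOL.refl, of vs] 1 by simp
  moreover have "cls t us = cls t us'"
    using cls_append_cong[OF HOL.refl triv, of us'] cls_rev_append[of "rev us'" t us] G by simp
  ultimately show ?thesis by simp
qed

section \<open>Straight elements\<close>

text \<open>Straightness becomes a check on a single period: \<open>C\<close> is a region that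
  forces positivity along \<open>w\<close> and is mapped into itself by it.\<close>

lemma pos_word_power:
  assumes "C (\<lambda>_. 1)" "\<And>v. C v \<Longrightarrow> pos_word t w v \<and> C (foldr (act t) w v)"
  shows "pos_word t (concat (replicate k w)) (\<lambda>_. 1)"
proof -
  have "pos_word t (concat (replicate k w)) (\<lambda>_. 1)
      \<and> C (foldr (act t) (concat (replicate k w)) (\<lambda>_. 1))"
    using assms by (induction k) (auto simp: pos_word_append)
  then show ?thesis ..
qed

lemma set_wword: "set (wword t i) \<subseteq> Gens"
  by (cases t) (auto simp: wword_def Gens_def)

text \<open>The last inequality of each cone says that the affine invariant is positive; the others are
  the orbit of the positivity conditions of one period, up to multiples of that invariant.\<close>

lemma pos_word_wword:
  assumes "i \<in> {1, 2}"
  shows "pos_word t (concat (replicate k (wword t i))) (\<lambda>_. 1)"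
proof (cases t)
  case TA2
  show ?thesis
  proof (cases "i = 1")
    case True
    show ?thesis
      by (rule pos_word_power[where C = "\<lambda>v. 0 < v 1 \<and> 0 < v 1 + v 2 \<and> 0 < v 1 + v 2 + v 3"])
        (auto simp: TA2 True wword_def act_def coef_def Gens_def)
  next
    case False
    then have "i = 2" using assms by simp
    show ?thesis
      by (rule pos_word_power[where C = "\<lambda>v. 0 < v 2 \<and> 0 < v 1 + v 2 \<and> 0 < v 1 + v 2 + v 3"])
        (auto simp: TA2 \<open>i = 2\<close> wword_def act_def coef_def Gens_def)
  qed
next
  case TC2
  show ?thesis
  proof (cases "i = 1")
    case True
    show ?thesis
      by (rule pos_word_power[where C = "\<lambda>v. 0 < v 1 \<and> 0 < v 1 + v 2 \<and> 0 < 2 * v 1 + v 2 + v 3"])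
        (auto simp: TC2 True wword_def act_def coef_def Gens_def)
  next
    case False
    then have "i = 2" using assms by simp
    show ?thesis
      by (rule pos_word_power[where C = "\<lambda>v. 0 < v 2 \<and> 0 < v 1 + v 2 \<and> 0 < 2 * v 1 + v 2
            \<and> 0 < 2 * v 1 + v 2 + v 3"])
        (auto simp: TC2 \<open>i = 2\<close> wword_def act_def coef_def Gens_def)
  qed
next
  case TG2
  show ?thesis
  proof (cases "i = 1")
    case True
    show ?thesis
      by (rule pos_word_power[where C = "\<lambda>v. 0 < v 2 \<and> 0 < v 1 + v 2 \<and> 0 < v 1 + v 2 + v 3
            \<and> 0 < 3 * v 1 + 2 * v 2 \<and> 0 < 2 * v 1 + v 2 \<and> 0 < 2 * v 1 + v 2 + v 3"])
        (auto simp: TG2 True wword_def act_def coef_def Gens_def)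
  next
    case False
    then have "i = 2" using assms by simp
    show ?thesis
      by (rule pos_word_power[where C = "\<lambda>v. 0 < v 2 \<and> 0 < 3 * v 1 + v 2 \<and> 0 < v 1 + v 2
            \<and> 0 < 2 * v 1 + v 2 \<and> 0 < 3 * v 1 + 2 * v 2 \<and> 0 < 2 * v 1 + v 2 + v 3"])
        (auto simp: TG2 \<open>i = 2\<close> wword_def act_def coef_def Gens_def)
  qed
qed

lemma len_wword_power:
  assumes "i \<in> {1, 2}"
  shows "len (cls t (concat (replicate k (wword t i)))) = k * length (wword t i)"
proof -
  have "set (concat (replicate k (wword t i))) \<subseteq> Gens"
    using set_wword[of t i] by auto
  moreover have "length (concat (replicate k (wword t i))) = k * length (wword t i)"
    by (induction k) auto
  ultimately show ?thesis
    using len_append_pos_word[of "concat (replicate k (wword t i))" "[]" t] pos_word_wword[OF assms]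
    by simp
qed

section \<open>Products of classes\<close>

definition wmul :: "afftype \<Rightarrow> nat list set \<Rightarrow> nat list set \<Rightarrow> nat list set" where
  "wmul t v w = cls t ((SOME xs. v = cls t xs) @ (SOME ys. w = cls t ys))"

lemma wmul_cls: "wmul t (cls t xs) (cls t ys) = cls t (xs @ ys)"
proof -
  have "cls t zs = cls t (SOME xs. cls t zs = cls t xs)" for zs
    by (rule someI) (rule HOL.refl)
  then show ?thesis
    unfolding wmul_def by (metis cls_append_cong)
qed

lemma Wgrp_iff: "w \<in> Wgrp t \<longleftrightarrow> (\<exists>xs. set xs \<subseteq> Gens \<and> w = cls t xs)"
  by (auto simp: Wgrp_def Wsub_def)

lemma wmul_in_Wgrp: "v \<in> Wgrp t \<Longrightarrow> w \<in> Wgrp t \<Longrightarrow> wmul t v w \<in> Wgrp t"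
  unfolding Wgrp_iff by (metis le_sup_iff set_append wmul_cls)

lemma Wsub_subset: "I \<subseteq> Gens \<Longrightarrow> Wsub t I \<subseteq> Wgrp t"
  by (auto simp: Wgrp_def Wsub_def)

text \<open>There are finitely many words of each length over three letters. This makes the
  coefficients of \<open>ser\<close> genuine sums, since a sum over an infinite set defaults to
  0.\<close>

lemma finite_level: "D \<subseteq> Wgrp t \<Longrightarrow> finite {w \<in> D. len w = n}"
proof -
  assume D: "D \<subseteq> Wgrp t"
  have "{w \<in> D. len w = n} \<subseteq> cls t ` {xs. set xs \<subseteq> Gens \<and> length xs = n}"
  proof
    fix w assume w: "w \<in> {w \<in> D. len w = n}"
    then obtain xs where xs: "set xs \<subseteq> Gens" "w = cls t xs"
      using D Wgrp_iff by blast
    obtain ys where "cls t ys = w" "length ys = len w" "set ys \<subseteq> Gens"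
      using reduced_word_exists[OF xs(1), of t] xs(2) by metis
    then show "w \<in> cls t ` {xs. set xs \<subseteq> Gens \<and> length xs = n}"
      using w by blast
  qed
  then show ?thesis
    using finite_lists_length_eq[of Gens n] by (auto simp: Gens_def intro: finite_subset)
qed

text \<open>By \<open>pt_sign\<close> these are the elements without left descents in \<open>I\<close>.\<close>

definition minrep :: "afftype \<Rightarrow> nat set \<Rightarrow> nat list set set" where
  "minrep t I = {cls t xs | xs. set xs \<subseteq> Gens \<and> (\<forall>s\<in>I. 0 < pt t xs s)}"

lemma minrep_subset: "minrep t I \<subseteq> Wgrp t"
  unfolding minrep_def Wgrp_def Wsub_def by blast

lemma cls_in_minrep_iff:
  assumes "set xs \<subseteq> Gens"
  shows "cls t xs \<in> minrep t I \<longleftrightarrow> (\<forall>s\<in>I. 0 < pt t xs s)"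
  using assms unfolding minrep_def by (auto dest: pt_cong)

lemma minrep_Int: "minrep t I \<inter> minrep t J = minrep t (I \<union> J)"
proof (rule set_eqI)
  fix w
  show "w \<in> minrep t I \<inter> minrep t J \<longleftrightarrow> w \<in> minrep t (I \<union> J)"
  proof (cases "w \<in> Wgrp t")
    case True
    then show ?thesis
      unfolding Wgrp_iff by (auto simp: cls_in_minrep_iff)
  next
    case False
    then show ?thesis using minrep_subset by blast
  qed
qed

text \<open>The first letter of a nonempty reduced word would be a left descent.\<close>

lemma minrep_Gens: "minrep t Gens = {cls t []}"
proof
  show "{cls t []} \<subseteq> minrep t Gens"
    by (simp add: cls_in_minrep_iff)
  show "minrep t Gens \<subseteq> {cls t []}"
  proof
    fix w assume "w \<in> minrep t Gens"
    then obtain xs where xs: "w = cls t xs" "set xs \<subseteq> Gens" "\<forall>s\<in>Gens. 0 < pt t xs s"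
      unfolding minrep_def by blast
    obtain ys where ys: "cls t ys = cls t xs" "length ys = len (cls t xs)" "set ys \<subseteq> Gens"
      using reduced_word_exists[OF xs(2), of t] by metis
    have "ys = []"
    proof (cases ys)
      case (Cons s zs)
      then have s: "s \<in> Gens" "set zs \<subseteq> Gens" using ys(3) by auto
      have "len (cls t (s # ys)) = Suc (length ys)"
        using pt_sign(1)[OF s(1) ys(3), of t] pt_cong[OF ys(1)] xs(3) s(1) ys(1,2) by simp
      moreover have "cls t (s # ys) = cls t zs"
        using Cons cls_cancel[OF s(1)] by simp
      ultimately show ?thesis
        using len_cls_le[of t zs] Cons by simp
    qed
    then show "w \<in> {cls t []}"
      using xs(1) ys(1) by simp
  qed
qed

lemma Wgrp_eq_minreps: "Wgrp t = minrep t {1} \<union> minrep t {2} \<union> minrep t {3}"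
proof
  show "Wgrp t \<subseteq> minrep t {1} \<union> minrep t {2} \<union> minrep t {3}"
  proof
    fix w assume "w \<in> Wgrp t"
    then obtain xs where "set xs \<subseteq> Gens" "w = cls t xs"
      unfolding Wgrp_iff by blast
    then show "w \<in> minrep t {1} \<union> minrep t {2} \<union> minrep t {3}"
      using pt_not_all_negative[of t xs] by (auto simp: cls_in_minrep_iff Gens_def)
  qed
qed (use minrep_subset in blast)

lemma parabolic_bij:
  assumes "s \<in> Gens" "r \<in> Gens"
  shows "bij_betw (\<lambda>(v, w). wmul t v w) (Wsub t {s, r} \<times> minrep t {s, r}) (Wgrp t)"
    and "v \<in> Wsub t {s, r} \<Longrightarrow> w \<in> minrep t {s, r} \<Longrightarrow> len (wmul t v w) = len v + len w"
proof -
  have sub: "{s, r} \<subseteq> Gens" using assms by simp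
  show "len (wmul t v w) = len v + len w" if "v \<in> Wsub t {s, r}" "w \<in> minrep t {s, r}" for v w
    using that len_parabolic_append[OF assms]
    unfolding Wsub_def minrep_def by (auto simp: wmul_cls)
  show "bij_betw (\<lambda>(v, w). wmul t v w) (Wsub t {s, r} \<times> minrep t {s, r}) (Wgrp t)"
    unfolding bij_betw_def
  proof
    show "inj_on (\<lambda>(v, w). wmul t v w) (Wsub t {s, r} \<times> minrep t {s, r})"
    proof (rule inj_onI)
      fix p p'
      assume p: "p \<in> Wsub t {s, r} \<times> minrep t {s, r}" "p' \<in> Wsub t {s, r} \<times> minrep t {s, r}"
        and eq: "(\<lambda>(v, w). wmul t v w) p = (\<lambda>(v, w). wmul t v w) p'"
      obtain us vs where 1: "p = (cls t us, cls t vs)" "set us \<subseteq> {s, r}" "set vs \<subseteq> Gens"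
          "0 < pt t vs s" "0 < pt t vs r"
        using p(1) unfolding Wsub_def minrep_def by auto
      obtain us' vs' where 2: "p' = (cls t us', cls t vs')" "set us' \<subseteq> {s, r}" "set vs' \<subseteq> Gens"
          "0 < pt t vs' s" "0 < pt t vs' r"
        using p(2) unfolding Wsub_def minrep_def by auto
      show "p = p'"
        using coset_decomposition_unique[OF assms 1(2) 2(2) 1(3-5) 2(3-5)] eq 1(1) 2(1)
        by (simp add: wmul_cls)
    qed
    show "(\<lambda>(v, w). wmul t v w) ` (Wsub t {s, r} \<times> minrep t {s, r}) = Wgrp t"
    proof
      show "(\<lambda>(v, w). wmul t v w) ` (Wsub t {s, r} \<times> minrep t {s, r}) \<subseteq> Wgrp t"
        using Wsub_subset[OF sub, of t] minrep_subset[of t "{s, r}"] by (auto intro!: wmul_in_Wgrp)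
      show "Wgrp t \<subseteq> (\<lambda>(v, w). wmul t v w) ` (Wsub t {s, r} \<times> minrep t {s, r})"
      proof
        fix w assume "w \<in> Wgrp t"
        then obtain xs where "set xs \<subseteq> Gens" and w: "w = cls t xs"
          unfolding Wgrp_iff by blast
        from coset_decomposition[OF sub this(1), of t] obtain us vs
          where uv: "set us \<subseteq> {s, r}" "set vs \<subseteq> Gens" "\<forall>a\<in>{s, r}. 0 < pt t vs a"
            "cls t xs = cls t (us @ vs)" by metis
        have "cls t us \<in> Wsub t {s, r}" "cls t vs \<in> minrep t {s, r}"
          using uv by (auto simp: Wsub_def cls_in_minrep_iff)
        moreover have "w = wmul t (cls t us) (cls t vs)"
          using uv(4) w by (simp add: wmul_cls)
        ultimately show "w \<in> (\<lambda>(v, w). wmul t v w) ` (Wsub t {s, r} \<times> minrep t {s, r})"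
          by force
      qed
    qed
  qed
qed

section \<open>The ring of power series of additive endomorphisms\<close>

text \<open>This is not an instance of \<open>ring_1\<close>, because \<open>0 = 1\<close> when the space is trivial.\<close>

typedef (overloaded) 'v opser =
  "{A :: nat \<Rightarrow> 'v::ab_group_add \<Rightarrow> 'v. \<forall>n x y. A n (x + y) = A n x + A n y}"
  morphisms coeffs Opser
  by (rule exI[of _ "\<lambda>_ _. 0"]) simp

setup_lifting type_definition_opser

lemma additive_sum:
  fixes f :: "'v::ab_group_add \<Rightarrow> 'v"
  assumes "\<And>x y. f (x + y) = f x + f y"
  shows "f (sum g A) = (\<Sum>i\<in>A. f (g i))"
proof (rule sum_comp_morphism[of f g A, unfolded o_def, symmetric])
  show "f 0 = 0" using assms[of 0 0] by simp
qed (rule assms)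

text \<open>Additivity is asked of \<open>A\<close> because only \<open>A\<close> is moved past a
  sum. In this form the lemma applies to an arbitrary candidate inverse in
  \<open>ps_inv_coeffs\<close>.\<close>

lemma ps_mult_assoc:
  fixes A B C :: "nat \<Rightarrow> 'v::ab_group_add \<Rightarrow> 'v"
  assumes "\<And>n x y. A n (x + y) = A n x + A n y"
  shows "ps_mult (ps_mult A B) C = ps_mult A (ps_mult B C)"
proof (intro ext)
  fix n x
  have A_sum: "A i (sum g S) = (\<Sum>j\<in>S. A i (g j))" for i and g :: "nat \<Rightarrow> 'v" and S
    by (rule additive_sum) (rule assms)
  show "ps_mult (ps_mult A B) C n x = ps_mult A (ps_mult B C) n x"
    using fps_mult_assoc_lemma[of "\<lambda>i j k. A i (B j (C k x))" n n]
    by (simp add: ps_mult_def A_sum atLeast0AtMost)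
qed

lemma ps_mult_one_left: "ps_mult ps_one A = (A :: nat \<Rightarrow> 'v \<Rightarrow> 'v::comm_monoid_add)"
proof (intro ext)
  fix n x
  have "ps_mult ps_one A n x = (\<Sum>i\<le>n. if i = 0 then A n x else 0)"
    unfolding ps_mult_def by (rule sum.cong) (auto simp: ps_one_def)
  then show "ps_mult ps_one A n x = A n x" by simp
qed

lemma ps_mult_one_right:
  fixes A :: "nat \<Rightarrow> 'v::ab_group_add \<Rightarrow> 'v"
  assumes "\<And>n x y. A n (x + y) = A n x + A n y"
  shows "ps_mult A ps_one = A"
proof (intro ext)
  fix n x
  have zero: "A i 0 = 0" for i
    using assms[of i 0 0] by simp
  have "ps_mult A ps_one n x = (\<Sum>i\<le>n. if i = n then A n x else 0)"
    unfolding ps_mult_def by (rule sum.cong) (auto simp: ps_one_def zero)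
  then show "ps_mult A ps_one n x = A n x" by simp
qed

instantiation opser :: (ab_group_add) "{ring, monoid_mult}"
begin

lift_definition zero_opser :: "'a opser" is "\<lambda>_ _. 0"
  by simp

lift_definition one_opser :: "'a opser" is ps_one
  by (simp add: ps_one_def)

lift_definition plus_opser :: "'a opser \<Rightarrow> 'a opser \<Rightarrow> 'a opser" is "\<lambda>A B n x. A n x + B n x"
  by (simp add: algebra_simps)

lift_definition minus_opser :: "'a opser \<Rightarrow> 'a opser \<Rightarrow> 'a opser" is "\<lambda>A B n x. A n x - B n x"
  by (simp add: algebra_simps)

lift_definition uminus_opser :: "'a opser \<Rightarrow> 'a opser" is "\<lambda>A n x. - A n x"
  by simp

lift_definition times_opser :: "'a opser \<Rightarrow> 'a opser \<Rightarrow> 'a opser" is ps_mult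
  by (simp add: ps_mult_def sum.distrib)

instance
proof
  fix A B C :: "'a opser"
  show "A * B * C = A * (B * C)"
    by transfer (rule ps_mult_assoc, blast)
  show "(A + B) * C = A * C + B * C"
    by transfer (simp add: ps_mult_def sum.distrib fun_eq_iff)
  show "A * (B + C) = A * B + A * C"
    by transfer (simp add: ps_mult_def sum.distrib fun_eq_iff)
  show "1 * A = A"
    by transfer (rule ps_mult_one_left)
  show "A * 1 = A"
    by transfer (rule ps_mult_one_right, blast)
qed (transfer; auto simp: algebra_simps)+

end

section \<open>Inverses of series whose constant term is the identity\<close>

lemma coeffs_add: "coeffs A n (x + y) = coeffs A n x + coeffs A n y"
  using coeffs[of A] by simp

text \<open>The recursion solves L A = 1 for the coefficient of index n, given that
  \<open>A 0\<close> is the identity.\<close>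

fun linv :: "(nat \<Rightarrow> 'v \<Rightarrow> 'v) \<Rightarrow> nat \<Rightarrow> 'v \<Rightarrow> 'v::ab_group_add" where
  "linv A n x = (if n = 0 then x else - (\<Sum>i<n. linv A i (A (n - i) x)))"

declare linv.simps [simp del]

lemma left_inverse_exists:
  fixes A :: "'v::ab_group_add opser"
  assumes "coeffs A 0 = id"
  obtains B where "B * A = 1" "coeffs B 0 = id"
proof -
  define L where "L = linv (coeffs A)"
  have add: "L n (x + y) = L n x + L n y" for n x y
    unfolding L_def
  proof (induction n arbitrary: x y rule: less_induct)
    case (less n)
    then show ?case
      by (subst (1 2 3) linv.simps) (simp add: coeffs_add sum.distrib)
  qed
  have "ps_mult L (coeffs A) n x = ps_one n x" for n x
  proof (cases "n = 0")
    case True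
    then show ?thesis
      using assms by (simp add: ps_mult_def ps_one_def L_def linv.simps)
  next
    case False
    have "ps_mult L (coeffs A) n x = L n x + (\<Sum>i<n. L i (coeffs A (n - i) x))"
      using assms by (simp add: ps_mult_def lessThan_Suc_atMost[symmetric])
    also have "\<dots> = 0"
      unfolding L_def by (subst linv.simps) (simp add: False)
    finally show ?thesis
      using False by (simp add: ps_one_def)
  qed
  then have "ps_mult L (coeffs A) = ps_one"
    by (intro ext)
  moreover have "coeffs (Opser L) = L"
    by (rule Opser_inverse) (use add in simp)
  ultimately have "Opser L * A = 1"
    by (simp add: coeffs_inject[symmetric] times_opser.rep_eq one_opser.rep_eq)
  moreover have "coeffs (Opser L) 0 = id"
    using \<open>coeffs (Opser L) = L\<close> by (auto simp: L_def linv.simps)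
  ultimately show ?thesis by (rule that)
qed

text \<open>A left inverse \<open>B\<close> again has constant term the identity, so it has a left
  inverse \<open>C\<close>; then C = C B A = A, and \<open>B\<close> is two-sided.\<close>

lemma inverse_exists:
  fixes A :: "'v::ab_group_add opser"
  assumes "coeffs A 0 = id"
  obtains B where "A * B = 1" "B * A = 1"
proof -
  obtain B where B: "B * A = 1" "coeffs B 0 = id"
    using left_inverse_exists[OF assms] by blast
  obtain C where C: "C * B = 1"
    using left_inverse_exists[OF B(2)] by blast
  have "C = A"
    using B(1) C by (metis mult.assoc mult_1_left mult_1_right)
  then show ?thesis using that B(1) C by blast
qed

text \<open>\<open>ps_inv\<close> ranges over all sequences of functions; that the inverse is nevertheless unique
  uses additivity of the known inverse only.\<close>

lemma ps_inv_coeffs: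
  fixes A B :: "'v::ab_group_add opser"
  assumes "A * B = 1" "B * A = 1"
  shows "ps_inv (coeffs A) = coeffs B"
  unfolding ps_inv_def
proof (rule the_equality)
  show "ps_mult (coeffs A) (coeffs B) = ps_one \<and> ps_mult (coeffs B) (coeffs A) = ps_one"
    using assms by (simp flip: times_opser.rep_eq one_opser.rep_eq)
  fix C assume C: "ps_mult (coeffs A) C = ps_one \<and> ps_mult C (coeffs A) = ps_one"
  have BA: "ps_mult (coeffs B) (coeffs A) = ps_one"
    using assms by (simp flip: times_opser.rep_eq one_opser.rep_eq)
  have "C = ps_mult (ps_mult (coeffs B) (coeffs A)) C"
    unfolding BA by (simp add: ps_mult_one_left)
  also have "\<dots> = ps_mult (coeffs B) ps_one"
    using C by (simp add: ps_mult_assoc coeffs_add)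
  also have "\<dots> = coeffs B"
    by (simp add: ps_mult_one_right coeffs_add)
  finally show "C = coeffs B" .
qed

lemma ps_prod_coeffs: "ps_prod (map coeffs As) = coeffs (prod_list As)"
  by (induction As) (simp_all add: ps_prod_def times_opser.rep_eq one_opser.rep_eq)

section \<open>Noncommutative identities\<close>

text \<open>An abstract ring separates the computation from power series. The expansions of
  \<open>w12\<close>, \<open>w13\<close>, \<open>w23\<close> and the braid relations depend on the
  type and enter as hypotheses of each product lemma.\<close>

locale parabolic_inverses =
  fixes x y z ix iy iz w12 w13 w23 i12 i13 i23 :: "'a::{ring,monoid_mult}"
  assumes inv_x: "(1 + x) * ix = 1" "ix * (1 + x) = 1"
    and inv_y: "(1 + y) * iy = 1" "iy * (1 + y) = 1"
    and inv_z: "(1 + z) * iz = 1" "iz * (1 + z) = 1"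
    and inv_12: "w12 * i12 = 1" "i12 * w12 = 1"
    and inv_13: "w13 * i13 = 1" "i13 * w13 = 1"
    and inv_23: "w23 * i23 = 1" "i23 * w23 = 1"
begin

definition Q :: 'a where
  "Q = 1 - ix - iy - iz + i12 + i13 + i23"

lemma inverse_cancel:
  "(1 + x) * (ix * A) = A" "ix * ((1 + x) * A) = A"
  "(1 + y) * (iy * A) = A" "iy * ((1 + y) * A) = A"
  "(1 + z) * (iz * A) = A" "iz * ((1 + z) * A) = A"
  "w12 * (i12 * A) = A" "i12 * (w12 * A) = A"
  "w13 * (i13 * A) = A" "i13 * (w13 * A) = A"
  "w23 * (i23 * A) = A" "i23 * (w23 * A) = A"
  using inv_x inv_y inv_z inv_12 inv_13 inv_23 by (simp_all flip: mult.assoc)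

lemmas inverse_simps = inv_x inv_y inv_z inv_12 inv_13 inv_23 inverse_cancel

text \<open>For order 2 the parabolic series splits into commuting factors 1 + y and 1 + z. Hence
  the three factors belonging to the letters 2 and 3 can be placed next to each other and
  cancel.\<close>

lemma commuting_pair:
  assumes "w23 = 1 + y + z + y * z" "y * z = z * y"
  shows "w23 * iy * iz = 1" "i23 = iz * iy"
proof -
  have yz: "w23 = (1 + y) * (1 + z)" "w23 = (1 + z) * (1 + y)"
    using assms by (simp_all add: algebra_simps)
  show "w23 * iy * iz = 1"
    unfolding yz(2) by (simp add: mult.assoc inverse_simps)
  have "i23 = i23 * (w23 * (iz * iy))"
    unfolding yz(1) by (simp add: mult.assoc inverse_simps)
  then show "i23 = iz * iy"
    by (simp add: inverse_simps)
qed

text \<open>Multiplying \<open>Q\<close> by \<open>ix * w13\<close> on the left and by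
  \<open>w12\<close> on the right clears every inverse. What remains factors as the product of the
  denominators of the two geometric series, in the order in which \<open>ib\<close> and then
  \<open>ia\<close> cancel them.\<close>

lemma product_C2:
  assumes w12: "w12 = 1 + x + y + x*y + y*x + x*y*x + y*x*y + x*y*x*y"
    and w13: "w13 = 1 + x + z + x*z + z*x + x*z*x + z*x*z + x*z*x*z"
    and w23: "w23 = 1 + y + z + y*z"
    and br: "x*y*x*y = y*x*y*x" "y*z = z*y"
    and a: "(1 - z*x*y*x) * ia = 1" "ia * (1 - z*x*y*x) = 1"
    and b: "(1 - z*x*y) * ib = 1" "ib * (1 - z*x*y) = 1"
  shows "w12 * ia * ib * ix * w13 * (w23 * iy * iz) * Q = 1"
proof -
  \<comment> \<open>Each is a sum over minimal coset representatives: \<open>Z\<close> in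
    \<open>w13\<close> and \<open>U\<close> in \<open>w12\<close> without left descent 1,
    \<open>V\<close> in \<open>w12\<close> without left descent 2.\<close>
  define Z where "Z = 1 + z + z*x + z*x*z"
  define U where "U = 1 + y + y*x + y*x*y"
  define V where "V = 1 + x + x*y + x*y*x"
  have Z: "ix * w13 = Z"
  proof -
    have "w13 = (1 + x) * Z" unfolding w13 Z_def by (simp add: algebra_simps)
    then show ?thesis by (simp add: inverse_simps)
  qed
  have U: "ix * w12 = U"
  proof -
    have "w12 = (1 + x) * U" unfolding w12 U_def by (simp add: algebra_simps)
    then show ?thesis by (simp add: inverse_simps)
  qed
  have V: "iy * w12 = V"
  proof -
    have "w12 = (1 + y) * V" unfolding w12 V_def using br(1) by (simp add: algebra_simps)
    then show ?thesis by (simp add: inverse_simps)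
  qed
  have Z_iz: "Z * iz = 1 + z*x"
  proof -
    have "Z = (1 + z*x) * (1 + z)" unfolding Z_def by (simp add: algebra_simps)
    then show ?thesis by (simp add: mult.assoc inverse_simps)
  qed
  have Z_i13: "Z * i13 = ix"
    unfolding Z[symmetric] by (simp add: mult.assoc inverse_simps)
  have "Z * Q * w12 = Z * w12 - Z * (ix * w12) - Z * (iy * w12) - (Z * iz) * w12 + Z * (i12 * w12)
      + (Z * i13) * w12 + (Z * iz) * (iy * w12)"
    unfolding Q_def by (simp add: commuting_pair(2)[OF w23 br(2)] algebra_simps)
  also have "\<dots> = Z * w12 - Z * U - Z * V - (1 + z*x) * w12 + Z + U + (1 + z*x) * V"
    by (simp add: U V Z_iz Z_i13 inverse_simps)
  also have "\<dots> = Z * (x*y*x*y) + U - (1 + z*x) * (y + y*x + y*x*y + x*y*x*y)"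
    unfolding w12 U_def V_def by (simp add: algebra_simps)
  also have "\<dots> = 1 - z*x*y - z*x*y*x + z*x*z*(x*y*x*y)"
    unfolding Z_def U_def by (simp add: algebra_simps)
  \<comment> \<open>The braid relation of order 4 brings \<open>y\<close> next to \<open>z\<close>,
    and commuting the two produces the last term of the expanded product below.\<close>
  also have "z*x*z*(x*y*x*y) = z*x*(y*z)*x*y*x"
    unfolding br by (simp add: mult.assoc)
  also have "1 - z*x*y - z*x*y*x + z*x*(y*z)*x*y*x = (1 - z*x*y) * (1 - z*x*y*x)"
    by (simp add: algebra_simps)
  finally have key: "Z * Q * w12 = (1 - z*x*y) * (1 - z*x*y*x)" .
  have "w12 * ia * ib * ix * w13 * (w23 * iy * iz) * Q
      = w12 * (ia * (ib * (Z * Q * w12))) * i12"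
    unfolding commuting_pair(1)[OF w23 br(2)] by (simp add: mult.assoc inverse_simps flip: Z)
  also have "\<dots> = 1"
    unfolding key using a b by (simp add: inverse_simps flip: mult.assoc)
  finally show ?thesis .
qed

text \<open>The same clearing of inverses, now with \<open>w13\<close> on the left and
  \<open>X = w12 * ix\<close> on the right of \<open>Q\<close>. Since \<open>X\<close> is invertible
  with inverse \<open>(1 + x) * i12\<close>, the factor on the right can be removed
  afterwards.\<close>

lemma product_G2:
  assumes w12: "w12 = 1 + x + y + x*y + y*x + x*y*x + y*x*y + x*y*x*y + y*x*y*x
        + x*y*x*y*x + y*x*y*x*y + x*y*x*y*x*y"
    and w13: "w13 = 1 + x + z + x*z + z*x + x*z*x"
    and w23: "w23 = 1 + y + z + y*z"
    and br: "x*y*x*y*x*y = y*x*y*x*y*x" "x*z*x = z*x*z" "y*z = z*y"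
    and a: "(1 - z*x*y) * ia = 1" "ia * (1 - z*x*y) = 1"
    and b: "(1 - z*x*y*x*y) * ib = 1" "ib * (1 - z*x*y*x*y) = 1"
  shows "w12 * ix * ib * ia * w13 * (w23 * iy * iz) * Q = 1"
proof -
  define X where "X = 1 + y + x*y + y*x*y + x*y*x*y + y*x*y*x*y"
  define V where "V = 1 + x*y + x*y*x*y"
  define Y where "Y = 1 + x + z*x"
  define Y' where "Y' = 1 + z + x*z"
  have X: "w12 * ix = X"
  proof -
    have "w12 = X * (1 + x)" unfolding w12 X_def br(1) by (simp add: algebra_simps)
    then show ?thesis by (simp add: mult.assoc inverse_simps)
  qed
  have V: "iy * X = V"
  proof -
    have "X = (1 + y) * V" unfolding X_def V_def by (simp add: algebra_simps)
    then show ?thesis by (simp add: inverse_simps)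
  qed
  have Y: "w13 * iz = Y"
  proof -
    have "w13 = Y * (1 + z)" unfolding w13 Y_def br(2) by (simp add: algebra_simps)
    then show ?thesis by (simp add: mult.assoc inverse_simps)
  qed
  have Y': "w13 * ix = Y'"
  proof -
    have "w13 = Y' * (1 + x)" unfolding w13 Y'_def by (simp add: algebra_simps)
    then show ?thesis by (simp add: mult.assoc inverse_simps)
  qed
  have i12_X: "i12 * X = ix"
    unfolding X[symmetric] by (simp add: inverse_simps)
  have "w13 * Q * X = w13 * X - (w13 * ix) * X - w13 * (iy * X) - (w13 * iz) * X + w13 * (i12 * X)
      + (w13 * i13) * X + (w13 * iz) * (iy * X)"
    unfolding Q_def by (simp add: commuting_pair(2)[OF w23 br(3)] algebra_simps)
  also have "\<dots> = w13 * X - Y' * X - w13 * V - Y * X + Y' + X + Y * V"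
    by (simp add: V Y Y' i12_X inverse_simps)
  also have "\<dots> = x*z*x*X + Y' - (z + x*z + x*z*x) * V"
    unfolding w13 Y_def Y'_def by (simp add: algebra_simps)
  also have "\<dots> = 1 - z*x*y - z*x*y*x*y + (x*z*x)*y*x*y*x*y"
    unfolding X_def Y'_def V_def by (simp add: algebra_simps)
  also have "(x*z*x)*y*x*y*x*y = z*x*(y*z)*x*y*x*y"
    unfolding br by (simp add: mult.assoc)
  also have "1 - z*x*y - z*x*y*x*y + z*x*(y*z)*x*y*x*y = (1 - z*x*y) * (1 - z*x*y*x*y)"
    by (simp add: algebra_simps)
  finally have key: "w13 * Q * X = (1 - z*x*y) * (1 - z*x*y*x*y)" .
  have X_inv: "X * ((1 + x) * i12) = 1"
    unfolding X[symmetric] by (simp add: mult.assoc inverse_simps)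
  have "w12 * ix * ib * ia * w13 * (w23 * iy * iz) * Q
      = X * ib * ia * (w13 * Q) * (X * ((1 + x) * i12))"
    unfolding commuting_pair(1)[OF w23 br(3)] X X_inv by (simp add: mult.assoc)
  also have "\<dots> = X * (ib * (ia * (w13 * Q * X))) * ((1 + x) * i12)"
    by (simp add: mult.assoc)
  also have "\<dots> = 1"
    unfolding key using a b X_inv by (simp flip: mult.assoc)
  finally show ?thesis .
qed

text \<open>Clearing with \<open>Z = iy * w23\<close> and \<open>X = w12 * ix\<close> leaves one
  inverse: the two denominators enclose \<open>(1 + z) * i13\<close>. That middle term is the
  inverse of \<open>w13 * iz\<close>, which is why this factor stands between the two geometric
  series.\<close>

lemma product_A2:
  assumes w12: "w12 = 1 + x + y + x*y + y*x + x*y*x"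
    and w13: "w13 = 1 + x + z + x*z + z*x + x*z*x"
    and w23: "w23 = 1 + y + z + y*z + z*y + y*z*y"
    and br: "x*y*x = y*x*y" "x*z*x = z*x*z" "y*z*y = z*y*z"
    and a: "(1 - z*x*y) * ia = 1" "ia * (1 - z*x*y) = 1"
    and b: "(1 - z*y*x) * ib = 1" "ib * (1 - z*y*x) = 1"
  shows "w12 * ix * ia * w13 * iz * ib * iy * w23 * Q = 1"
proof -
  define X where "X = 1 + y + x*y"
  define Y where "Y = 1 + x + z*x"
  define Z where "Z = 1 + z + z*y"
  have X: "w12 * ix = X"
  proof -
    have "w12 = X * (1 + x)" unfolding w12 X_def by (simp add: algebra_simps)
    then show ?thesis by (simp add: mult.assoc inverse_simps)
  qed
  have w13_Y: "w13 = Y * (1 + z)"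
    unfolding w13 Y_def br(2) by (simp add: algebra_simps)
  have Y: "w13 * iz = Y"
    unfolding w13_Y by (simp add: mult.assoc inverse_simps)
  have Z: "iy * w23 = Z"
  proof -
    have "w23 = (1 + y) * Z" unfolding w23 Z_def by (simp add: algebra_simps)
    then show ?thesis by (simp add: inverse_simps)
  qed
  have D_Y: "i13 * Y = iz"
    unfolding Y[symmetric] by (simp add: inverse_simps)
  have Y_D: "(1 + x + x*z) * i13 = iz"
  proof -
    have "w13 = (1 + z) * (1 + x + x*z)" unfolding w13 br(2) by (simp add: algebra_simps)
    then have "iz * w13 = 1 + x + x*z" by (simp add: inverse_simps)
    then show ?thesis by (metis inv_13(1) mult.assoc mult_1_right)
  qed
  have i12_X: "i12 * X = ix"
    unfolding X[symmetric] by (simp add: inverse_simps)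
  have Z_i23: "Z * i23 = iy"
    unfolding Z[symmetric] by (simp add: mult.assoc inverse_simps)
  have Z_iy: "Z * iy = iy + z"
  proof -
    have "Z = 1 + z * (1 + y)" unfolding Z_def by (simp add: algebra_simps)
    then show ?thesis by (simp add: distrib_right[of 1 "z * (1 + y)"] mult.assoc inverse_simps)
  qed
  have ix_X: "ix * X = ix + y"
  proof -
    have "X = 1 + (1 + x) * y" unfolding X_def by (simp add: algebra_simps)
    then show ?thesis by (simp add: distrib_left inverse_simps)
  qed
  have Z_iz: "Z * iz = 1 + z*y*iz"
  proof -
    have "Z = (1 + z) + z*y" unfolding Z_def by simp
    then show ?thesis by (simp add: distrib_right[of "1 + z"] inverse_simps)
  qed
  \<comment> \<open>The defining relation of the inverse \<open>i13\<close> is used only through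
    \<open>D_Y\<close> and \<open>Y_D\<close>; here \<open>D_Y\<close> times \<open>y\<close>
    eliminates the monomial \<open>i13*x*y\<close>, and the next fact uses \<open>Y_D\<close> in the
    same way on the left.\<close>
  have D_xy: "i13*x*y = iz*y - i13*y - i13*z*x*y"
    using arg_cong[OF D_Y, of "\<lambda>u. u * y"] unfolding Y_def by (simp add: algebra_simps)
  have yD: "y*(x + x*z)*i13 = y*iz - y*i13"
    using arg_cong[OF Y_D, of "\<lambda>u. y * u"] by (simp add: algebra_simps)
  have iz_z: "iz * z = 1 - iz"
    using inv_z(2) by (simp add: algebra_simps)
  have z_iz: "z * iz = 1 - iz"
    using inv_z(1) by (simp add: algebra_simps)
  have "Z * Q * X = Z * X - Z * (ix * X) - (Z * iy) * X - (Z * iz) * X + Z * (i12 * X)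
      + Z * i13 * X + (Z * i23) * X"
    unfolding Q_def by (simp add: algebra_simps)
  also have "\<dots> = z*y*X - Z*y - z*y*iz*X + Z*i13*X"
    unfolding i12_X Z_i23 Z_iy ix_X Z_iz by (simp add: algebra_simps Z_def)
  also have "Z * i13 * X = (1 + z) * (i13 + i13*y + i13*x*y) + z*y*i13 + z*y*(i13*y + i13*x*y)"
    unfolding Z_def X_def by (simp add: algebra_simps)
  also have "\<dots> = (1 + z)*i13 + (1 + z)*iz*y - (1 + z)*i13*z*x*y + z*y*i13
      + z*y*iz*y - z*y*i13*z*x*y"
    unfolding D_xy by (simp add: algebra_simps)
  also have "z*y*X - Z*y - z*y*iz*X + \<dots>
      = (1 + z)*i13 - (1 + z)*i13*z*x*y - z*y*iz + z*y*i13 + z*y*(1 - iz)*x*y - z*y*i13*z*x*y"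
    unfolding inv_z(1) by (simp add: X_def Z_def algebra_simps)
  also have "\<dots> = (1 + z)*i13 - (1 + z)*i13*z*x*y - z*(y*iz - y*i13)
      + z*(y*iz - y*i13)*z*x*y"
    unfolding iz_z[symmetric] by (simp add: algebra_simps)
  \<comment> \<open>By \<open>yD\<close>, the bracket \<open>y*iz - y*i13\<close> equals
    \<open>y*x*(1 + z)*i13\<close>, so both factors split off.\<close>
  also have "\<dots> = (1 - z*y*x) * (1 + z) * i13 * (1 - z*x*y)"
    unfolding yD[symmetric] by (simp add: algebra_simps)
  finally have key: "Z * Q * X = (1 - z*y*x) * (1 + z) * i13 * (1 - z*x*y)" .
  have X_inv: "X * ((1 + x) * i12) = 1"
    unfolding X[symmetric] by (simp add: mult.assoc inverse_simps)
  have "w12 * ix * ia * w13 * iz * ib * iy * w23 * Q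
      = (w12 * ix) * ia * (w13 * iz) * ib * (iy * w23) * Q * (X * ((1 + x) * i12))"
    unfolding X_inv by (simp add: mult.assoc)
  also have "\<dots> = X * ia * Y * (ib * (Z * Q * X)) * ((1 + x) * i12)"
    unfolding X Y Z by (simp add: mult.assoc)
  also have "\<dots> = X * ia * (w13 * i13) * (1 - z*x*y) * ((1 + x) * i12)"
    unfolding key w13_Y using b by (simp flip: mult.assoc)
  also have "\<dots> = X * (ia * (1 - z*x*y)) * ((1 + x) * i12)"
    unfolding inv_13 by (simp add: mult.assoc)
  also have "\<dots> = 1"
    unfolding a using X_inv by simp
  finally show ?thesis .
qed

end

section \<open>The nine members of the collection\<close>

lemma psubsets_Gens: "{I. I \<subset> Gens} = {{}, {1}, {2}, {3}, {1, 2}, {1, 3}, {2, 3}}"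
proof
  have psubset: "I \<subset> Gens \<longleftrightarrow> I \<subseteq> Gens \<and> \<not> (1 \<in> I \<and> 2 \<in> I \<and> 3 \<in> I)" for I
    unfolding Gens_def by blast
  show "{{}, {1}, {2}, {3}, {1, 2}, {1, 3}, {2, 3}} \<subseteq> {I. I \<subset> Gens}"
    unfolding psubset by (simp add: Gens_def)
  show "{I. I \<subset> Gens} \<subseteq> {{}, {1}, {2}, {3}, {1, 2}, {1, 3}, {2, 3}}"
  proof
    fix I assume "I \<in> {I. I \<subset> Gens}"
    then have I: "\<And>i. i \<in> I \<Longrightarrow> i = 1 \<or> i = 2 \<or> i = 3" "\<not> (1 \<in> I \<and> 2 \<in> I \<and> 3 \<in> I)"
      unfolding psubset by (auto simp: Gens_def)
    have "I = (if 1 \<in> I then {1} else {}) \<union> (if 2 \<in> I then {2} else {}) \<union> (if 3 \<in> I then {3} else {})"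
      using I(1) by (auto split: if_splits)
    moreover have "(if 1 \<in> I then {1} else {}) \<union> (if 2 \<in> I then {2} else {})
        \<union> (if 3 \<in> I then {3} else {}) \<in> {{}, {1}, {2}, {3}, {1, 2}, {1, 3}, {2, 3 :: nat}}"
      using I(2) by (cases "1 \<in> I"; cases "2 \<in> I"; cases "3 \<in> I") (simp_all add: insert_commute)
    ultimately show "I \<in> {{}, {1}, {2}, {3}, {1, 2}, {1, 3}, {2, 3}}" by argo
  qed
qed

lemma factor_index_eq: "factor_index = {Inr {}, Inr {1}, Inr {2}, Inr {3},
  Inr {1, 2}, Inr {1, 3}, Inr {2, 3}, Inl 1, Inl 2}"
  unfolding factor_index_def psubsets_Gens by simp

section \<open>Series of a representation\<close>

locale hecke_module =
  fixes t :: afftype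
    and scale :: "'k::field \<Rightarrow> 'v::ab_group_add \<Rightarrow> 'v"
    and q :: 'k
    and \<rho> :: "nat list set \<Rightarrow> 'v \<Rightarrow> 'v"
  assumes rep: "hecke_rep t scale q \<rho>"
begin

lemma rho_add: "w \<in> Wgrp t \<Longrightarrow> \<rho> w (x + y) = \<rho> w x + \<rho> w y"
  using rep unfolding hecke_rep_def
  by (auto simp: Vector_Spaces.linear_def module_hom_def module_hom_axioms_def)

lemma rho_Nil: "\<rho> (cls t []) = id"
  using rep unfolding hecke_rep_def by blast

lemma rho_mul:
  assumes "v \<in> Wgrp t" "w \<in> Wgrp t" "len (wmul t v w) = len v + len w"
  shows "\<rho> (wmul t v w) x = \<rho> v (\<rho> w x)"
proof -
  obtain xs ys where "set xs \<subseteq> Gens" "set ys \<subseteq> Gens" "v = cls t xs" "w = cls t ys"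
    using assms(1,2) unfolding Wgrp_iff by blast
  moreover have "\<forall>xs ys. set xs \<subseteq> Gens \<longrightarrow> set ys \<subseteq> Gens \<longrightarrow>
        len (cls t (xs @ ys)) = len (cls t xs) + len (cls t ys) \<longrightarrow>
        \<rho> (cls t (xs @ ys)) = \<rho> (cls t xs) \<circ> \<rho> (cls t ys)"
    using rep unfolding hecke_rep_def by blast
  ultimately show ?thesis
    using assms(3) by (simp add: wmul_cls)
qed

text \<open>\<open>Opser\<close> is meaningful only on additive sequences, so facts about
  \<open>S D\<close> assume that \<open>D\<close> lies in \<open>Wgrp t\<close>, where the operators
  are linear.\<close>

definition S :: "nat list set set \<Rightarrow> 'v opser" where
  "S D = Opser (ser \<rho> D)"

lemma coeffs_S: "D \<subseteq> Wgrp t \<Longrightarrow> coeffs (S D) = ser \<rho> D"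
  unfolding S_def
proof (rule Opser_inverse)
  assume D: "D \<subseteq> Wgrp t"
  have "ser \<rho> D n (x + y) = ser \<rho> D n x + ser \<rho> D n y" for n x y
    unfolding ser_def sum.distrib[symmetric]
    by (rule sum.cong) (use D in \<open>auto intro: rho_add\<close>)
  then show "ser \<rho> D \<in> {A. \<forall>n x y. A n (x + y) = A n x + A n y}" by simp
qed

lemma S_eqI:
  assumes "A \<subseteq> Wgrp t" "\<And>n x. coeffs B n x = (\<Sum>w\<in>{w\<in>A. len w = n}. \<rho> w x)"
  shows "B = S A"
  unfolding coeffs_inject[symmetric] coeffs_S[OF assms(1)]
  by (intro ext) (simp add: ser_def assms(2))

lemma S_Un:
  assumes "A \<subseteq> Wgrp t" "B \<subseteq> Wgrp t"
  shows "S (A \<union> B) + S (A \<inter> B) = S A + S B"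
proof -
  have AB: "A \<union> B \<subseteq> Wgrp t" "A \<inter> B \<subseteq> Wgrp t" using assms by auto
  have "ser \<rho> (A \<union> B) n x + ser \<rho> (A \<inter> B) n x = ser \<rho> A n x + ser \<rho> B n x" for n x
  proof -
    have sets: "{w \<in> A \<union> B. len w = n} = {w \<in> A. len w = n} \<union> {w \<in> B. len w = n}"
      "{w \<in> A \<inter> B. len w = n} = {w \<in> A. len w = n} \<inter> {w \<in> B. len w = n}"
      by auto
    show ?thesis
      unfolding ser_def sets by (rule sum.union_inter; rule finite_level; rule assms)
  qed
  then show ?thesis
    by (simp add: coeffs_inject[symmetric] plus_opser.rep_eq coeffs_S assms AB)
qed

lemma S_empty: "S {} = 0"
  by (rule S_eqI[symmetric]) (simp_all add: zero_opser.rep_eq)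

lemma S_disjoint_Un:
  "A \<subseteq> Wgrp t \<Longrightarrow> B \<subseteq> Wgrp t \<Longrightarrow> A \<inter> B = {} \<Longrightarrow> S (A \<union> B) = S A + S B"
  using S_Un[of A B] by (simp add: S_empty)

lemma cls_in_Wgrp: "set xs \<subseteq> Gens \<Longrightarrow> cls t xs \<in> Wgrp t"
  unfolding Wgrp_iff by blast

lemma S_Nil: "S {cls t []} = 1"
proof (rule S_eqI[symmetric])
  show "{cls t []} \<subseteq> Wgrp t" by (simp add: cls_in_Wgrp)
  fix n x
  have "{w \<in> {cls t []}. len w = n} = (if n = 0 then {cls t []} else {})" by auto
  then show "coeffs 1 n x = (\<Sum>w\<in>{w \<in> {cls t []}. len w = n}. \<rho> w x)"
    by (simp add: one_opser.rep_eq ps_one_def rho_Nil)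
qed

lemma S_image:
  assumes "finite K" "inj_on f K" "f ` K \<subseteq> Wgrp t"
  shows "S (f ` K) = (\<Sum>k\<in>K. S {f k})"
  using assms
proof (induction K rule: finite_induct)
  case (insert k K)
  have "S (f ` insert k K) = S ({f k} \<union> f ` K)" by simp
  also have "\<dots> = S {f k} + S (f ` K)"
    by (rule S_disjoint_Un) (use insert in auto)
  finally show ?case using insert by simp
qed (simp add: S_empty)

text \<open>The passage from group combinatorics to series: a length-additive bijection matches the
  convolution of coefficients with a sum over \<open>C\<close>. It yields the parabolic
  factorization, the products of generators and the shift by a straight element.\<close>

lemma S_mult:
  assumes A: "A \<subseteq> Wgrp t" and B: "B \<subseteq> Wgrp t"
    and bij: "bij_betw (\<lambda>(v, w). wmul t v w) (A \<times> B) C"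
    and len_mul: "\<And>v w. v \<in> A \<Longrightarrow> w \<in> B \<Longrightarrow> len (wmul t v w) = len v + len w"
  shows "S A * S B = S C"
proof (rule S_eqI)
  show "C \<subseteq> Wgrp t"
    using bij A B by (auto simp: bij_betw_def intro!: wmul_in_Wgrp)
  fix n x
  \<comment> \<open>The index \<open>i\<close> is the length of \<open>v\<close>; keeping it fits
    the convolution, and \<open>g\<close> forgets it without losing injectivity.\<close>
  let ?P = "SIGMA i:{..n}. {v \<in> A. len v = i} \<times> {w \<in> B. len w = n - i}"
  define g where "g = (\<lambda>(i :: nat, v, w). wmul t v w)"
  have fin: "finite {v \<in> A. len v = i}" "finite {v \<in> B. len v = i}" for i
    using finite_level A B by auto
  have "coeffs (S A * S B) n x = (\<Sum>i\<le>n. \<Sum>v\<in>{v\<in>A. len v = i}. \<rho> v (\<Sum>w\<in>{w\<in>B. len w = n - i}. \<rho> w x))"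
    by (simp add: times_opser.rep_eq ps_mult_def coeffs_S A B) (simp add: ser_def)
  also have "\<dots> = (\<Sum>i\<le>n. \<Sum>v\<in>{v\<in>A. len v = i}. \<Sum>w\<in>{w\<in>B. len w = n - i}. \<rho> (wmul t v w) x)"
  proof (intro sum.cong HOL.refl)
    fix i v assume v: "v \<in> {v \<in> A. len v = i}"
    have "\<rho> v (\<Sum>w\<in>{w\<in>B. len w = n - i}. \<rho> w x) = (\<Sum>w\<in>{w\<in>B. len w = n - i}. \<rho> v (\<rho> w x))"
      by (rule additive_sum) (use v A in \<open>auto intro: rho_add\<close>)
    also have "\<dots> = (\<Sum>w\<in>{w\<in>B. len w = n - i}. \<rho> (wmul t v w) x)"
      by (rule sum.cong) (use v A B len_mul in \<open>auto simp: rho_mul subset_eq\<close>)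
    finally show "\<rho> v (\<Sum>w\<in>{w\<in>B. len w = n - i}. \<rho> w x) = \<dots>" .
  qed
  also have "\<dots> = (\<Sum>p\<in>?P. \<rho> (g p) x)"
    by (simp add: sum.Sigma fin sum.cartesian_product g_def case_prod_unfold)
  also have "\<dots> = (\<Sum>w\<in>{w\<in>C. len w = n}. \<rho> w x)"
  proof (rule sum.reindex_bij_betw)
    show "bij_betw g ?P {w \<in> C. len w = n}"
      unfolding bij_betw_def
    proof
      have "inj_on (\<lambda>(v, w). wmul t v w) (A \<times> B)" using bij by (simp add: bij_betw_def)
      then show "inj_on g ?P"
        unfolding inj_on_def g_def by auto
      have C: "C = (\<lambda>(v, w). wmul t v w) ` (A \<times> B)" using bij by (simp add: bij_betw_def)
      show "g ` ?P = {w \<in> C. len w = n}"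
      proof
        show "g ` ?P \<subseteq> {w \<in> C. len w = n}"
          unfolding g_def C by (auto simp: len_mul)
        show "{w \<in> C. len w = n} \<subseteq> g ` ?P"
        proof
          fix c assume c: "c \<in> {w \<in> C. len w = n}"
          then obtain v w where vw: "v \<in> A" "w \<in> B" "c = wmul t v w" unfolding C by auto
          then have "(len v, v, w) \<in> ?P" using c len_mul by auto
          moreover have "c = g (len v, v, w)" using vw by (simp add: g_def)
          ultimately show "c \<in> g ` ?P" by blast
        qed
      qed
    qed
  qed
  finally show "coeffs (S A * S B) n x = (\<Sum>w\<in>{w\<in>C. len w = n}. \<rho> w x)" .
qed

section \<open>Monomials in the generators and dihedral sums\<close>

lemma S_mult_singletons:
  assumes "set xs \<subseteq> Gens" "set ys \<subseteq> Gens"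
    and "len (cls t (xs @ ys)) = len (cls t xs) + len (cls t ys)"
  shows "S {cls t xs} * S {cls t ys} = S {cls t (xs @ ys)}"
  by (rule S_mult) (use assms in \<open>auto simp: cls_in_Wgrp wmul_cls bij_betw_def\<close>)

text \<open>A monomial attached to a word, not to a group element; it is the series of the class
  when the word is reduced.\<close>

definition E :: "nat list \<Rightarrow> 'v opser" where
  "E xs = prod_list (map (\<lambda>s. S {cls t [s]}) xs)"

lemma E_simps [simp]: "E [] = 1" "E (s # r # xs) = E [s] * E (r # xs)"
  by (simp_all add: E_def)

lemma S_reduced:
  assumes "set xs \<subseteq> Gens" "len (cls t xs) = length xs"
  shows "S {cls t xs} = E xs"
  using assms
proof (induction xs)
  case Nil
  then show ?case by (simp add: S_Nil)
next
  case (Cons s xs)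
  have s: "s \<in> Gens" "set xs \<subseteq> Gens" using Cons.prems by auto
  have len: "len (cls t xs) = length xs"
    using len_Cons_cases[OF s, of t] len_cls_le[of t xs] Cons.prems(2) by auto
  have "len (cls t [s]) = 1"
    using len_append_pos_word[of "[s]" "[]" t] s by simp
  then have "S {cls t [s]} * S {cls t xs} = S {cls t (s # xs)}"
    using S_mult_singletons[of "[s]" xs] s Cons.prems(2) len by simp
  then show ?case
    using Cons.IH s len by (simp add: E_def)
qed

lemma len_alt:
  assumes "s \<in> Gens" "r \<in> Gens" "k \<le> cox_m t s r"
  shows "len (cls t (alt s r k)) = k"
proof -
  have "set (alt s r k) \<subseteq> Gens" using set_alt[of s r k] assms by auto
  then show ?thesis
    using len_append_pos_word[of "alt s r k" "[]" t] pos_word_alt[of s r "\<lambda>_. 1" k t] assms by simp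
qed

lemma S_alt:
  assumes "s \<in> Gens" "r \<in> Gens" "k \<le> cox_m t s r"
  shows "S {cls t (alt s r k)} = E (alt s r k)"
  by (rule S_reduced) (use set_alt[of s r k] assms len_alt in auto)

text \<open>Both alternating words are reduced words of the same element, so both monomials equal
  its series.\<close>

lemma E_braid:
  assumes "s \<in> Gens" "r \<in> Gens"
  shows "E (alt s r (cox_m t s r)) = E (alt r s (cox_m t s r))"
  using S_alt[OF assms, of "cox_m t s r"] S_alt[OF assms(2,1), of "cox_m t s r"]
    cls_braid[OF assms, of t] by (simp add: cox_m_sym)

text \<open>The ranges count the identity and the longest element once: both occur in the first
  family, so the second omits 0 and m.\<close>

lemma Wsub_dihedral:
  assumes "s \<in> Gens" "r \<in> Gens"
  shows "Wsub t {s, r} = (\<lambda>k. cls t (alt s r k)) ` {..cox_m t s r}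
           \<union> (\<lambda>k. cls t (alt r s k)) ` {1..<cox_m t s r}"
    (is "?L = ?A \<union> ?B")
proof
  show "?L \<subseteq> ?A \<union> ?B"
  proof
    fix w assume "w \<in> ?L"
    then obtain xs where xs: "set xs \<subseteq> {s, r}" "w = cls t xs" unfolding Wsub_def by blast
    obtain k a b where k: "k \<le> cox_m t s r" "{a, b} = {s, r}" "w = cls t (alt a b k)"
      using dihedral_word_alt[OF assms xs(1), of t] xs(2) by metis
    consider "a = s" "b = r" | "a = r" "b = s" "k = 0" | "a = r" "b = s" "k = cox_m t s r"
      | "a = r" "b = s" "k \<in> {1..<cox_m t s r}"
      using k(1,2) by (cases "k = 0") (auto simp: doubleton_eq_iff le_less[of k "cox_m t s r"])
    then show "w \<in> ?A \<union> ?B"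
    proof cases
      case 2
      then show ?thesis using k(3) by force
    next
      case 3
      then show ?thesis using k(3) cls_braid[OF assms, of t] by auto
    qed (use k in auto)
  qed
  have "cls t (alt s r k) \<in> ?L" "cls t (alt r s k) \<in> ?L" for k
    using set_alt[of s r k] set_alt[of r s k] unfolding Wsub_def by blast+
  then show "?A \<union> ?B \<subseteq> ?L" by auto
qed

lemma S_Wsub_dihedral:
  assumes "s \<in> Gens" "r \<in> Gens" "s \<noteq> r"
  shows "S (Wsub t {s, r}) = (\<Sum>k\<le>cox_m t s r. E (alt s r k)) + (\<Sum>k=1..<cox_m t s r. E (alt r s k))"
proof -
  let ?m = "cox_m t s r"
  let ?f = "\<lambda>k. cls t (alt s r k)" and ?g = "\<lambda>k. cls t (alt r s k)"
  have G: "set (alt s r k) \<subseteq> Gens" "set (alt r s k) \<subseteq> Gens" for k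
    using set_alt[of s r k] set_alt[of r s k] assms by auto
  have len: "k \<le> ?m \<Longrightarrow> len (?f k) = k" "k \<le> ?m \<Longrightarrow> len (?g k) = k" for k
    using len_alt[of s r k] len_alt[of r s k] assms by (auto simp: cox_m_sym[of t r s])
  have sub: "?f ` {..?m} \<subseteq> Wgrp t" "?g ` {1..<?m} \<subseteq> Wgrp t"
    using G cls_in_Wgrp by auto
  \<comment> \<open>Length forces equal indices, and two alternating words of the same length
    strictly between 0 and m are told apart by whether \<open>s\<close> is a left descent.\<close>
  have disj: "?f ` {..?m} \<inter> ?g ` {1..<?m} = {}"
  proof (rule ccontr)
    assume "\<not> ?thesis"
    then obtain j k where jk: "j \<le> ?m" "1 \<le> k" "k < ?m" "?f j = ?g k" by auto
    then have "j = k" using len[of j] len[of k] by simp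
    obtain n where n: "k = Suc n" using jk(2) by (cases k) auto
    have "0 < pt t (alt r s k) s"
      using act_alt_positive[OF assms, of "\<lambda>_. 1" k t] jk(3) by (simp add: pt_def)
    moreover have "0 < pt t (alt r s n) s"
      using act_alt_positive[OF assms, of "\<lambda>_. 1" n t] jk(3) n by (simp add: pt_def)
    then have "pt t (alt s r k) s < 0"
      by (simp add: n pt_Cons act_self)
    ultimately show False
      using pt_cong[OF jk(4)] \<open>j = k\<close> by simp
  qed
  have inj: "inj_on ?f {..?m}" "inj_on ?g {1..<?m}"
    by (auto intro!: inj_on_inverseI[of _ len] simp: len)
  have "S (Wsub t {s, r}) = S (?f ` {..?m}) + S (?g ` {1..<?m})"
    unfolding Wsub_dihedral[OF assms(1,2)] by (rule S_disjoint_Un[OF sub disj])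
  also have "\<dots> = (\<Sum>k\<le>?m. S {?f k}) + (\<Sum>k=1..<?m. S {?g k})"
    using sub inj by (simp add: S_image)
  also have "\<dots> = (\<Sum>k\<le>?m. E (alt s r k)) + (\<Sum>k=1..<?m. E (alt r s k))"
    using assms by (simp add: S_alt cox_m_sym[of t r s])
  finally show ?thesis .
qed

lemma S_Wsub_single:
  assumes "s \<in> Gens"
  shows "S (Wsub t {s}) = 1 + E [s]"
proof -
  have "len (cls t [s]) = 1"
    using len_append_pos_word[of "[s]" "[]" t] assms by simp
  then have ne: "cls t [] \<noteq> cls t [s]" using len_Nil by (metis zero_neq_one)
  have "Wsub t {s, s} = {cls t []} \<union> {cls t [s]}"
    unfolding Wsub_dihedral[OF assms assms] by (auto simp: cox_m_def atMost_Suc)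
  then show ?thesis
    using S_disjoint_Un[of "{cls t []}" "{cls t [s]}"] ne assms
    by (simp add: cls_in_Wgrp S_Nil E_def)
qed

section \<open>Inclusion-exclusion over left descents\<close>

lemma S_Wgrp_parabolic:
  assumes "s \<in> Gens" "r \<in> Gens"
  shows "S (Wgrp t) = S (Wsub t {s, r}) * S (minrep t {s, r})"
  by (rule S_mult[OF _ minrep_subset parabolic_bij[OF assms], symmetric])
    (use assms Wsub_subset[of "{s, r}" t] in auto)

text \<open>The three sets \<open>minrep t {s}\<close> cover W because no element has all left
  descents, and their common part is the identity alone, which contributes the 1.\<close>

lemma S_Wgrp_minreps:
  "S (Wgrp t) - S (minrep t {1}) - S (minrep t {2}) - S (minrep t {3})
    + S (minrep t {1, 2}) + S (minrep t {1, 3}) + S (minrep t {2, 3}) = 1"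
proof -
  let ?M = "minrep t"
  have sub: "?M I \<subseteq> Wgrp t" "?M I \<union> ?M J \<subseteq> Wgrp t" for I J
    using minrep_subset by auto
  have 1: "S (?M {1} \<union> ?M {2}) + S (?M {1, 2}) = S (?M {1}) + S (?M {2})"
    using S_Un[OF sub(1) sub(1), of "{1}" "{2}"] by (simp add: minrep_Int insert_commute)
  have "?M {1, 3} \<inter> ?M {2, 3} = {cls t []}"
    unfolding minrep_Int minrep_Gens[symmetric] Gens_def by (simp add: insert_commute)
  then have 2: "S (?M {1, 3} \<union> ?M {2, 3}) + 1 = S (?M {1, 3}) + S (?M {2, 3})"
    using S_Un[OF sub(1) sub(1), of "{1, 3}" "{2, 3}"] by (simp add: S_Nil)
  have "(?M {1} \<union> ?M {2}) \<inter> ?M {3} = ?M {1, 3} \<union> ?M {2, 3}"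
    by (simp add: Int_Un_distrib2 minrep_Int insert_commute)
  then have 3: "S (Wgrp t) + S (?M {1, 3} \<union> ?M {2, 3}) = S (?M {1} \<union> ?M {2}) + S (?M {3})"
    using S_Un[OF sub(2) sub(1), of "{1}" "{2}" "{3}"] by (simp add: Wgrp_eq_minreps)
  have "S (Wgrp t) = S (?M {1} \<union> ?M {2}) + S (?M {3}) - S (?M {1, 3} \<union> ?M {2, 3})"
    using 3 by (simp add: eq_diff_eq)
  also have "S (?M {1} \<union> ?M {2}) = S (?M {1}) + S (?M {2}) - S (?M {1, 2})"
    using 1 by (simp add: eq_diff_eq)
  also have "S (?M {1, 3} \<union> ?M {2, 3}) = S (?M {1, 3}) + S (?M {2, 3}) - 1"
    using 2 by (simp add: eq_diff_eq)
  finally show ?thesis by simp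
qed

section \<open>The geometric series of the straight elements\<close>

lemma Hset_subset: "Hset t i \<subseteq> Wgrp t"
proof -
  have "cls t (concat (replicate k (wword t i))) \<in> Wgrp t" for k
    by (rule cls_in_Wgrp) (use set_wword[of t i] in auto)
  then show ?thesis
    unfolding Hset_def by blast
qed

text \<open>The powers consist of the identity and the shift of all powers by \<open>w\<close>.
  Lengths add up along powers, so the shift is multiplication by \<open>E w\<close>, from either
  side as powers of \<open>w\<close> commute with \<open>w\<close>.\<close>

lemma S_Hset:
  assumes "i \<in> {1, 2}"
  shows "(1 - E (wword t i)) * S (Hset t i) = 1" "S (Hset t i) * (1 - E (wword t i)) = 1"
proof -
  let ?w = "wword t i"
  define p where "p k = cls t (concat (replicate k ?w))" for k
  have H: "Hset t i = range p"
    by (auto simp: Hset_def p_def)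
  have p_in: "p k \<in> Wgrp t" for k
    using Hset_subset[of i] H by blast
  have p_len: "len (p k) = k * length ?w" for k
    unfolding p_def by (rule len_wword_power[OF assms])
  have p_simps: "p 0 = cls t []" "p 1 = cls t ?w"
    by (simp_all add: p_def)
  have "concat (replicate k ?w) @ ?w = ?w @ concat (replicate k ?w)" for k
    by (induction k) auto
  then have p_mul: "wmul t (p 1) (p k) = p (Suc k)" "wmul t (p k) (p 1) = p (Suc k)" for k
    by (simp_all add: p_def wmul_cls)
  have pos: "0 < length ?w"
    by (cases t) (auto simp: wword_def)
  have inj: "p j = p k \<longleftrightarrow> j = k" for j k
  proof
    assume "p j = p k"
    then have "j * length ?w = k * length ?w"
      using p_len by metis
    then show "j = k" using pos by simp
  qed simp
  have "S {p 1} = E ?w"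
    unfolding p_simps by (rule S_reduced) (use set_wword p_len[of 1] p_simps in auto)
  have "p k \<in> insert (p 0) (range (\<lambda>k. p (Suc k)))" for k
    by (cases k) auto
  then have "range p = insert (p 0) (range (\<lambda>k. p (Suc k)))"
    by auto
  then have "S (range p) = S ({cls t []} \<union> range (\<lambda>k. p (Suc k)))"
    by (simp add: p_simps)
  also have "\<dots> = S {cls t []} + S (range (\<lambda>k. p (Suc k)))"
    by (rule S_disjoint_Un) (use p_in cls_in_Wgrp[of "[]"] in \<open>auto simp: inj simp flip: p_simps\<close>)
  finally have S_H: "S (range p) = 1 + S (range (\<lambda>k. p (Suc k)))"
    by (simp only: S_Nil)
  have sub: "{p 1} \<subseteq> Wgrp t" "range p \<subseteq> Wgrp t"
    using p_in by auto
  have "S {p 1} * S (range p) = S (range (\<lambda>k. p (Suc k)))"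
  proof (rule S_mult[OF sub])
    show "bij_betw (\<lambda>(v, w). wmul t v w) ({p 1} \<times> range p) (range (\<lambda>k. p (Suc k)))"
      by (auto simp: bij_betw_def inj_on_def p_mul[unfolded One_nat_def] inj image_def)
  qed (auto simp: p_mul[unfolded One_nat_def] p_len)
  then show "(1 - E ?w) * S (Hset t i) = 1"
    using S_H \<open>S {p 1} = E ?w\<close> by (simp add: H algebra_simps)
  have "S (range p) * S {p 1} = S (range (\<lambda>k. p (Suc k)))"
  proof (rule S_mult[OF sub(2,1)])
    show "bij_betw (\<lambda>(v, w). wmul t v w) (range p \<times> {p 1}) (range (\<lambda>k. p (Suc k)))"
      by (auto simp: bij_betw_def inj_on_def p_mul[unfolded One_nat_def] inj image_def)
  qed (auto simp: p_mul[unfolded One_nat_def] p_len)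
  then show "S (Hset t i) * (1 - E ?w) = 1"
    using S_H \<open>S {p 1} = E ?w\<close> by (simp add: H algebra_simps)
qed

lemma coeffs_Wsub_0: "I \<subseteq> Gens \<Longrightarrow> coeffs (S (Wsub t I)) 0 = id"
proof -
  assume I: "I \<subseteq> Gens"
  have "{w \<in> Wsub t I. len w = 0} = {cls t []}"
  proof
    show "{w \<in> Wsub t I. len w = 0} \<subseteq> {cls t []}"
      using I len_eq_0_iff by (fastforce simp: Wsub_def)
    show "{cls t []} \<subseteq> {w \<in> Wsub t I. len w = 0}"
      unfolding Wsub_def by force
  qed
  then show ?thesis
    by (simp add: coeffs_S Wsub_subset[OF I] ser_def rho_Nil id_def)
qed

lemma Wsub_inverse:
  assumes "I \<subseteq> Gens"
  obtains J where "S (Wsub t I) * J = 1" "J * S (Wsub t I) = 1"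
    "ps_inv (ser \<rho> (Wsub t I)) = coeffs J"
proof -
  obtain J where J: "S (Wsub t I) * J = 1" "J * S (Wsub t I) = 1"
    using inverse_exists[OF coeffs_Wsub_0[OF assms]] by blast
  moreover have "ps_inv (ser \<rho> (Wsub t I)) = coeffs J"
    using ps_inv_coeffs[OF J] by (simp add: coeffs_S Wsub_subset[OF assms])
  ultimately show ?thesis by (rule that)
qed

section \<open>Explicit parabolic series for the orders 2, 3, 4 and 6\<close>

lemma dihedral_2:
  assumes "s \<in> Gens" "r \<in> Gens" "s \<noteq> r" "cox_m t s r = 2"
  shows "S (Wsub t {s, r}) = 1 + E [s] + E [r] + E [s] * E [r]" "E [s] * E [r] = E [r] * E [s]"
  using S_Wsub_dihedral[OF assms(1-3)] E_braid[OF assms(1,2)]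
  by (simp_all add: assms(4) eval_nat_numeral algebra_simps)

lemma dihedral_3:
  assumes "s \<in> Gens" "r \<in> Gens" "s \<noteq> r" "cox_m t s r = 3"
  defines "x \<equiv> E [s]" and "y \<equiv> E [r]"
  shows "S (Wsub t {s, r}) = 1 + x + y + x*y + y*x + x*y*x" "x*y*x = y*x*y"
  using S_Wsub_dihedral[OF assms(1-3)] E_braid[OF assms(1,2)]
  by (simp_all add: assms(4) x_def y_def eval_nat_numeral algebra_simps)

lemma dihedral_4:
  assumes "s \<in> Gens" "r \<in> Gens" "s \<noteq> r" "cox_m t s r = 4"
  defines "x \<equiv> E [s]" and "y \<equiv> E [r]"
  shows "S (Wsub t {s, r}) = 1 + x + y + x*y + y*x + x*y*x + y*x*y + x*y*x*y" "x*y*x*y = y*x*y*x"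
  using S_Wsub_dihedral[OF assms(1-3)] E_braid[OF assms(1,2)]
  by (simp_all add: assms(4) x_def y_def eval_nat_numeral algebra_simps)

lemma dihedral_6:
  assumes "s \<in> Gens" "r \<in> Gens" "s \<noteq> r" "cox_m t s r = 6"
  defines "x \<equiv> E [s]" and "y \<equiv> E [r]"
  shows "S (Wsub t {s, r}) = 1 + x + y + x*y + y*x + x*y*x + y*x*y + x*y*x*y + y*x*y*x
      + x*y*x*y*x + y*x*y*x*y + x*y*x*y*x*y" "x*y*x*y*x*y = y*x*y*x*y*x"
  using S_Wsub_dihedral[OF assms(1-3)] E_braid[OF assms(1,2)]
  by (simp_all add: assms(4) x_def y_def eval_nat_numeral algebra_simps)

section \<open>Assembling the ordered product\<close>

lemma product_exists:
  "\<exists>L. distinct L \<and> set L = factor_index \<and> ps_prod (map (factor t \<rho>) L) = ser \<rho> (Wgrp t)"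
proof -
  have G: "1 \<in> Gens" "2 \<in> Gens" "3 \<in> Gens" by (simp_all add: Gens_def)
  obtain ix where ix: "S (Wsub t {1}) * ix = 1" "ix * S (Wsub t {1}) = 1"
      "ps_inv (ser \<rho> (Wsub t {1})) = coeffs ix"
    by (rule Wsub_inverse[of "{1}"]) (use G in auto)
  obtain iy where iy: "S (Wsub t {2}) * iy = 1" "iy * S (Wsub t {2}) = 1"
      "ps_inv (ser \<rho> (Wsub t {2})) = coeffs iy"
    by (rule Wsub_inverse[of "{2}"]) (use G in auto)
  obtain iz where iz: "S (Wsub t {3}) * iz = 1" "iz * S (Wsub t {3}) = 1"
      "ps_inv (ser \<rho> (Wsub t {3})) = coeffs iz"
    by (rule Wsub_inverse[of "{3}"]) (use G in auto)
  obtain i12 where i12: "S (Wsub t {1, 2}) * i12 = 1" "i12 * S (Wsub t {1, 2}) = 1"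
    by (rule Wsub_inverse[of "{1, 2}"]) (use G in auto)
  obtain i13 where i13: "S (Wsub t {1, 3}) * i13 = 1" "i13 * S (Wsub t {1, 3}) = 1"
    by (rule Wsub_inverse[of "{1, 3}"]) (use G in auto)
  obtain i23 where i23: "S (Wsub t {2, 3}) * i23 = 1" "i23 * S (Wsub t {2, 3}) = 1"
    by (rule Wsub_inverse[of "{2, 3}"]) (use G in auto)
  let ?x = "E [1]" and ?y = "E [2]" and ?z = "E [3]"
  let ?w12 = "S (Wsub t {1, 2})" and ?w13 = "S (Wsub t {1, 3})" and ?w23 = "S (Wsub t {2, 3})"
  interpret parabolic_inverses ?x ?y ?z ix iy iz ?w12 ?w13 ?w23 i12 i13 i23
    by unfold_locales
      (use ix iy iz i12 i13 i23 in \<open>simp_all only: S_Wsub_single[OF G(1)] S_Wsub_single[OF G(2)] S_Wsub_single[OF G(3)]\<close>)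
  \<comment> \<open>Taking \<open>s = r\<close> covers the singletons, since \<open>{s, s}\<close>
    is \<open>{s}\<close>.\<close>
  have div: "J * S (Wgrp t) = S (minrep t {s, r})"
    if "J * S (Wsub t {s, r}) = 1" "s \<in> Gens" "r \<in> Gens" for J s r
    using that by (simp add: S_Wgrp_parabolic[OF that(2,3)] flip: mult.assoc)
  have "Q * S (Wgrp t) = S (Wgrp t) - ix * S (Wgrp t) - iy * S (Wgrp t) - iz * S (Wgrp t)
      + i12 * S (Wgrp t) + i13 * S (Wgrp t) + i23 * S (Wgrp t)"
    unfolding Q_def by (simp add: algebra_simps)
  also have "\<dots> = 1"
    using div[of ix 1 1] div[of iy 2 2] div[of iz 3 3] div[of i12 1 2] div[of i13 1 3]
      div[of i23 2 3] ix iy iz i12 i13 i23 G S_Wgrp_minreps by simp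
  finally have QW: "Q * S (Wgrp t) = 1" .
  \<comment> \<open>A left inverse and a right inverse of \<open>Q\<close> agree.\<close>
  have W_eq: "P = S (Wgrp t)" if "P * Q = 1" for P
  proof -
    have "P = P * (Q * S (Wgrp t))" by (simp add: QW)
    also have "\<dots> = P * Q * S (Wgrp t)" by (simp only: mult.assoc)
    finally show ?thesis by (simp add: that)
  qed
  have "Wsub t {} = {cls t []}"
    by (auto simp: Wsub_def)
  then have factors: "factor t \<rho> (Inl i) = coeffs (S (Hset t i))" "factor t \<rho> (Inr {}) = coeffs 1"
    "factor t \<rho> (Inr {1}) = coeffs ix" "factor t \<rho> (Inr {2}) = coeffs iy"
    "factor t \<rho> (Inr {3}) = coeffs iz" "factor t \<rho> (Inr {1, 2}) = coeffs ?w12"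
    "factor t \<rho> (Inr {1, 3}) = coeffs ?w13" "factor t \<rho> (Inr {2, 3}) = coeffs ?w23" for i
    using ix(3) iy(3) iz(3) G
    by (simp_all add: factor_def coeffs_S Hset_subset Wsub_subset S_Nil[symmetric] cls_in_Wgrp)
  have conclude: ?thesis
    if "distinct L" "set L = factor_index" "map (factor t \<rho>) L = map coeffs As"
      "prod_list As * Q = 1" for L As
  proof -
    have "ps_prod (map (factor t \<rho>) L) = ser \<rho> (Wgrp t)"
      using W_eq[OF that(4)] by (simp add: that(3) ps_prod_coeffs coeffs_S)
    then show ?thesis using that by blast
  qed
  have ne: "1 \<noteq> (2 :: nat)" "1 \<noteq> (3 :: nat)" "2 \<noteq> (3 :: nat)" by simp_all
  have H1: "(1 - E (wword t 1)) * S (Hset t 1) = 1" "S (Hset t 1) * (1 - E (wword t 1)) = 1"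
    and H2: "(1 - E (wword t 2)) * S (Hset t 2) = 1" "S (Hset t 2) * (1 - E (wword t 2)) = 1"
    using S_Hset[of 1] S_Hset[of 2] by simp_all
  show ?thesis
  proof (cases t)
    case TA2
    have m: "cox_m t 1 2 = 3" "cox_m t 1 3 = 3" "cox_m t 2 3 = 3"
      by (simp_all add: TA2 cox_m_def doubleton_eq_iff)
    have "wword t 1 = [3, 2, 1]" "wword t 2 = [3, 1, 2]"
      by (simp_all add: TA2 wword_def)
    then have w: "E (wword t 1) = ?z * ?y * ?x" "E (wword t 2) = ?z * ?x * ?y"
      by (simp_all add: mult.assoc)
    note d12 = dihedral_3[OF G(1,2) ne(1) m(1)] and d13 = dihedral_3[OF G(1,3) ne(2) m(2)]
      and d23 = dihedral_3[OF G(2,3) ne(3) m(3)]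
    have prod: "?w12 * ix * S (Hset t 2) * ?w13 * iz * S (Hset t 1) * iy * ?w23 * Q = 1"
      by (rule product_A2[OF d12(1) d13(1) d23(1) d12(2) d13(2) d23(2) H2[unfolded w] H1[unfolded w]])
    show ?thesis
    proof (rule conclude)
      \<comment> \<open>The order is that of \<open>product_A2\<close>, where the first geometric
        series belongs to \<open>z*x*y\<close>, that is to the second element. The trivial factor of
        the empty set goes last, here and in the other types.\<close>
      show "map (factor t \<rho>) [Inr {1, 2}, Inr {1}, Inl 2, Inr {1, 3}, Inr {3}, Inl 1, Inr {2},
          Inr {2, 3}, Inr {}]
        = map coeffs [?w12, ix, S (Hset t 2), ?w13, iz, S (Hset t 1), iy, ?w23, 1]"
        by (simp only: list.map factors)
    qed (use prod in \<open>auto simp: factor_index_eq doubleton_eq_iff mult.assoc\<close>)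
  next
    case TC2
    have m: "cox_m t 1 2 = 4" "cox_m t 1 3 = 4" "cox_m t 2 3 = 2"
      by (simp_all add: TC2 cox_m_def doubleton_eq_iff)
    have "wword t 1 = [3, 1, 2, 1]" "wword t 2 = [3, 1, 2]"
      by (simp_all add: TC2 wword_def)
    then have w: "E (wword t 1) = ?z * ?x * ?y * ?x" "E (wword t 2) = ?z * ?x * ?y"
      by (simp_all add: mult.assoc)
    note d12 = dihedral_4[OF G(1,2) ne(1) m(1)] and d13 = dihedral_4[OF G(1,3) ne(2) m(2)]
      and d23 = dihedral_2[OF G(2,3) ne(3) m(3)]
    have prod: "?w12 * S (Hset t 1) * S (Hset t 2) * ix * ?w13 * (?w23 * iy * iz) * Q = 1"
      by (rule product_C2[OF d12(1) d13(1) d23(1) d12(2) d23(2) H1[unfolded w] H2[unfolded w]])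
    show ?thesis
    proof (rule conclude)
      show "map (factor t \<rho>) [Inr {1, 2}, Inl 1, Inl 2, Inr {1}, Inr {1, 3}, Inr {2, 3}, Inr {2},
          Inr {3}, Inr {}]
        = map coeffs [?w12, S (Hset t 1), S (Hset t 2), ix, ?w13, ?w23, iy, iz, 1]"
        by (simp only: list.map factors)
    qed (use prod in \<open>auto simp: factor_index_eq doubleton_eq_iff mult.assoc\<close>)
  next
    case TG2
    have m: "cox_m t 1 2 = 6" "cox_m t 1 3 = 3" "cox_m t 2 3 = 2"
      by (simp_all add: TG2 cox_m_def doubleton_eq_iff)
    have "wword t 1 = [3, 1, 2]" "wword t 2 = [3, 1, 2, 1, 2]"
      by (simp_all add: TG2 wword_def)
    then have w: "E (wword t 1) = ?z * ?x * ?y" "E (wword t 2) = ?z * ?x * ?y * ?x * ?y"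
      by (simp_all add: mult.assoc)
    note d12 = dihedral_6[OF G(1,2) ne(1) m(1)] and d13 = dihedral_3[OF G(1,3) ne(2) m(2)]
      and d23 = dihedral_2[OF G(2,3) ne(3) m(3)]
    have prod: "?w12 * ix * S (Hset t 2) * S (Hset t 1) * ?w13 * (?w23 * iy * iz) * Q = 1"
      by (rule product_G2[OF d12(1) d13(1) d23(1) d12(2) d13(2) d23(2) H1[unfolded w] H2[unfolded w]])
    show ?thesis
    proof (rule conclude)
      show "map (factor t \<rho>) [Inr {1, 2}, Inr {1}, Inl 2, Inl 1, Inr {1, 3}, Inr {2, 3}, Inr {2},
          Inr {3}, Inr {}]
        = map coeffs [?w12, ix, S (Hset t 2), S (Hset t 1), ?w13, ?w23, iy, iz, 1]"
        by (simp only: list.map factors)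
    qed (use prod in \<open>auto simp: factor_index_eq doubleton_eq_iff mult.assoc\<close>)
  qed
qed

end

theorem theorem3p2:
  fixes t :: afftype
    and scale :: "'k::field \<Rightarrow> 'v::ab_group_add \<Rightarrow> 'v"
    and q :: 'k
    and \<rho> :: "nat list set \<Rightarrow> 'v \<Rightarrow> 'v"
  assumes "vector_space scale"
    and "hecke_rep t scale q \<rho>"
  shows "\<exists>L. distinct L \<and> set L = factor_index \<and>
             ps_prod (map (factor t \<rho>) L) = ser \<rho> (Wgrp t)"
proof -
  interpret hecke_module t scale q \<rho>
    by unfold_locales (rule assms(2))
  show ?thesis by (rule product_exists)
qed

end
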